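(* Let $m\in\mathbb{N}$ and let $V=\sum_{k\in\mathbb{Z}}\widehat V(2k)e^{i2k\pi x}\in H_{+}^{-m}$ be a 1-periodic complex-valued distribution. Then: (a) the operators $S_{\pm}(V)$ are $m$-sectorial with respect to an arbitrary angle containing the positive half-axis, i.e. for every $\varepsilon>0$ there is a constant $c_\varepsilon\ge0$ such that $|\arg((S_{\pm}(V)+c_\varepsilon I)u,u)|\le\varepsilon$ for all $u\in\mathrm{Dom}(S_\pm)$; (b) the operators $S_{\pm}(V)$ are selfadjoint if and only if $V$ is real-valued, i.e. $\widehat V(2k)=\overline{\widehat V(-2k)}$ for all $k\in\mathbb{Z}$; (c) the operators $S_{\pm}(V)$ have discrete spectra.
   Context: For $s\in\mathbb{R}$, $H_{+}^{s}$ is the space of formal series $f=\sum_{k\in\mathbb{Z}}\widehat f(2k)e^{i2k\pi x}$ with $\|f\|_{H_+^s}^2=\sum_k\langle 2k\rangle^{2s}|\widehat f(2k)|^2<\infty$, and $H_{-}^{s}$ is the space of formal series $f=\sum_{k}\widehat f(2k+1)e^{i(2k+1)\pi x}$ with $\|f\|_{H_-^s}^2=\sum_k\langle 2k+1\rangle^{2s}|\widehat f(2k+1)|^2<\infty$, where $\langle k\rangle=1+|k|$; $H_\pm^0=L_2(0,1)$. $\langle\cdot,\cdot\rangle_{\pm}$ is the pairing between $H_\pm^{s}$ and $H_\pm^{-s}$ extending the $L_2(0,1)$ inner product $(\cdot,\cdot)$. $D_{\pm}=-i\,d/dx$ on $H_\pm^1$, $D_\pm^{2m}=|D_\pm|^{2m}$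 (multiplication by $(n\pi)^{2m}$ on the mode $e^{in\pi x}$). For $u\in H_\pm^{m}$, $V(x)u=\sum_n\big(\sum_j\widehat V(n-j)\widehat u(j)\big)e^{in\pi x}\in H_\pm^{-m}$. $S_{\pm}(V)=D_{\pm}^{2m}\dotplus V$ is the $m$-sectorial operator on $L_2(0,1)$ associated with the closed sectorial form $t_\pm[u,v]=\langle D_{\pm}^{2m}u,v\rangle_{\pm}+\langle V(x)u,v\rangle_{\pm}$, $\mathrm{Dom}(t_\pm)=H_\pm^m$; explicitly $\mathrm{Dom}(S_{\pm})=\{u\in H_{\pm}^{m}\mid D_{\pm}^{2m}u+V(x)u\in L_{2}(0,1)\}$ and $S_\pm(V)u=D_{\pm}^{2m}u+V(x)u$. An operator is $m$-sectorial if its numerical range lies in a sector $\{|\arg(\lambda-\gamma)|\le\theta\}$, $\gamma\in\mathbb{R}$, $0\le\theta<\pi/2$, whose exterior lies in the resolvent set. Discrete spectrum means the spectrum consists of isolated eigenvalues of finite algebraic multiplicity. *)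

theory Defs
  imports "HOL-Complex_Analysis.Complex_Analysis"
begin

text \<open>Coefficient model.  A function in L2(0,1) is represented by its coefficient
  sequence with respect to the orthonormal basis e^{i(2k+s)pi x}, k in Z, where
  s = 0 for the periodic (+) case and s = 1 for the antiperiodic (-) case.
  This identification is unitary, so all spectral notions are preserved.
  The parameter pm :: bool selects the sign: True = (+), False = (-).\<close>

type_synonym seq = "int \<Rightarrow> complex"

definition freq :: "bool \<Rightarrow> int \<Rightarrow> int" where
  "freq pm k = 2 * k + (if pm then 0 else 1)"

definition jbr :: "int \<Rightarrow> real" where
  "jbr n = 1 + real_of_int \<bar>n\<bar>"

definition l2 :: "seq set" where
  "l2 = {f. (\<lambda>k. (cmod (f k))\<^sup>2) summable_on UNIV}"

definition l2_inner :: "seq \<Rightarrow> seq \<Rightarrow> complex" where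
  "l2_inner f g = infsum (\<lambda>k. f k * cnj (g k)) UNIV"

definition l2_norm :: "seq \<Rightarrow> real" where
  "l2_norm f = sqrt (infsum (\<lambda>k. (cmod (f k))\<^sup>2) UNIV)"

text \<open>Sobolev space H^s_{pm}, in coefficients; k-th coefficient is the one of mode
  e^{i freq pm k pi x}.\<close>
definition Hs :: "bool \<Rightarrow> real \<Rightarrow> seq set" where
  "Hs pm s = {f. (\<lambda>k. jbr (freq pm k) powr (2 * s) * (cmod (f k))\<^sup>2) summable_on UNIV}"

text \<open>V k stands for the Fourier coefficient hat V(2k).  Multiplication V(x)u:
  the coefficient of mode 2k+s is sum_j hat V(2(k-j)) hat u(2j+s).\<close>
definition mult_V :: "seq \<Rightarrow> seq \<Rightarrow> seq" where
  "mult_V V u = (\<lambda>k. infsum (\<lambda>j. V (k - j) * u j) UNIV)"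

definition Dpow :: "nat \<Rightarrow> bool \<Rightarrow> seq \<Rightarrow> seq" where
  "Dpow m pm u = (\<lambda>k. complex_of_real ((real_of_int (freq pm k) * pi) ^ (2 * m)) * u k)"

definition S_op :: "nat \<Rightarrow> seq \<Rightarrow> bool \<Rightarrow> seq \<Rightarrow> seq" where
  "S_op m V pm u = (\<lambda>k. Dpow m pm u k + mult_V V u k)"

definition S_dom :: "nat \<Rightarrow> seq \<Rightarrow> bool \<Rightarrow> seq set" where
  "S_dom m V pm = {u \<in> Hs pm (real m). S_op m V pm u \<in> l2}"

definition resolvent_set :: "seq set \<Rightarrow> (seq \<Rightarrow> seq) \<Rightarrow> complex set" where
  "resolvent_set D T = {z.
     (\<forall>f\<in>l2. \<exists>!u. u \<in> D \<and> (\<lambda>k. T u k - z * u k) = f) \<and>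
     (\<exists>C. \<forall>u\<in>D. l2_norm u \<le> C * l2_norm (\<lambda>k. T u k - z * u k))}"

definition op_spectrum :: "seq set \<Rightarrow> (seq \<Rightarrow> seq) \<Rightarrow> complex set" where
  "op_spectrum D T = - resolvent_set D T"

definition resolvent :: "seq set \<Rightarrow> (seq \<Rightarrow> seq) \<Rightarrow> complex \<Rightarrow> seq \<Rightarrow> seq" where
  "resolvent D T z f = (THE u. u \<in> D \<and> (\<lambda>k. T u k - z * u k) = f)"

definition riesz_range :: "seq set \<Rightarrow> (seq \<Rightarrow> seq) \<Rightarrow> complex \<Rightarrow> real \<Rightarrow> seq set" where
  "riesz_range D T w r = {(\<lambda>k. contour_integral (circlepath w r) (\<lambda>z. resolvent D T z f k)
                                / (2 * pi * \<i>)) | f. f \<in> l2}"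

definition finite_dim :: "seq set \<Rightarrow> bool" where
  "finite_dim A \<longleftrightarrow> (\<exists>n (b :: nat \<Rightarrow> seq). \<forall>v\<in>A. \<exists>c :: nat \<Rightarrow> complex.
       v = (\<lambda>k. \<Sum>j<n. c j * b j k))"

definition discrete_spectrum :: "seq set \<Rightarrow> (seq \<Rightarrow> seq) \<Rightarrow> bool" where
  "discrete_spectrum D T \<longleftrightarrow> (\<forall>w\<in>op_spectrum D T.
     (\<exists>u\<in>D. u \<noteq> (\<lambda>_. 0) \<and> T u = (\<lambda>k. w * u k)) \<and>
     (\<exists>r>0. (\<forall>z. 0 < cmod (z - w) \<and> cmod (z - w) \<le> r \<longrightarrow> z \<in> resolvent_set D T) \<and>
            finite_dim (riesz_range D T w r)))"

definition m_sectorial :: "seq set \<Rightarrow> (seq \<Rightarrow> seq) \<Rightarrow> bool" where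
  "m_sectorial D T \<longleftrightarrow> (\<exists>(\<gamma>::real) \<theta>. 0 \<le> \<theta> \<and> \<theta> < pi / 2 \<and>
     (\<forall>u\<in>D. l2_norm u = 1 \<longrightarrow> \<bar>Arg (l2_inner (T u) u - complex_of_real \<gamma>)\<bar> \<le> \<theta>) \<and>
     (\<forall>z. \<bar>Arg (z - complex_of_real \<gamma>)\<bar> > \<theta> \<longrightarrow> z \<in> resolvent_set D T))"

definition selfadjoint :: "seq set \<Rightarrow> (seq \<Rightarrow> seq) \<Rightarrow> bool" where
  "selfadjoint D T \<longleftrightarrow> D \<subseteq> l2 \<and> (\<forall>u\<in>D. T u \<in> l2) \<and>
     (\<forall>u\<in>D. \<forall>v\<in>D. l2_inner (T u) v = l2_inner u (T v)) \<and>
     (\<forall>g\<in>l2. \<forall>h\<in>l2. (\<forall>u\<in>D. l2_inner (T u) g = l2_inner u h) \<longrightarrow> g \<in> D \<and> T g = h)"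

end

theory Submission
  imports Defs "Jordan_Normal_Form.Determinant"
begin

text \<open>
  Let \<open>d\<^sub>k\<close> be the eigenvalues of the unperturbed operator and \<open>w\<^sub>k = d\<^sub>k + \<mu>\<close>. Substituting
  \<open>u = w\<^bsup>-1/2\<^esup> x\<close> turns \<open>S - z\<close> into \<open>w\<^bsup>1/2\<^esup> (I - L\<^sub>z) w\<^bsup>1/2\<^esup>\<close> with \<open>L\<^sub>z = (z + \<mu>) w\<^bsup>-1\<^esup> - K\<close> and
  \<open>K = w\<^bsup>-1/2\<^esup> V w\<^bsup>-1/2\<^esup>\<close>. Since \<open>2m > 1\<close>, the condition on \<open>V\<close> says that \<open>K\<close> is Hilbert--Schmidt, and
  its norm tends to \<open>0\<close> as \<open>\<mu> \<rightarrow> \<infinity>\<close>: this makes the numerical range of \<open>S + \<mu>\<close> lie in arbitrarily thin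
  sectors and makes \<open>- \<mu>\<close> a regular point. Symmetry of \<open>S\<close> is equivalent to symmetry of \<open>K\<close>, because
  \<open>w\<^bsup>1/2\<^esup> Dom(S)\<close> is dense.

  On a disc, splitting off finitely many rows of \<open>L\<^sub>z\<close> leaves a matrix of Hilbert--Schmidt norm at most
  \<open>1/2\<close>, which is inverted by a Neumann series; invertibility of \<open>I - L\<^sub>z\<close> then amounts to
  \<open>\<Delta>(z) \<noteq> 0\<close> for a finite determinant \<open>\<Delta>\<close> holomorphic in \<open>z\<close>. Zeros of \<open>\<Delta>\<close> are isolated eigenvalues,
  and Cramer's rule exhibits the singular part of the resolvent as a combination of finitely many
  holomorphic vectors divided by \<open>\<Delta>\<close>, so the Riesz projections have finite rank.
\<close>

section \<open>The sequence space\<close>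

text \<open>Multiplication by \<open>V\<close> sends H^m only into H^(-m), so \<open>S_dom\<close>
  is described implicitly and need not contain any basis vector; arguments with explicit test
  vectors cannot be run on it directly. The factorization through w^(1/2) moves every question to a
  bounded equation on all of \<open>l2\<close>, and the domain condition is recovered from the
  equation itself. The Hilbert-Schmidt norm is the convenient one because it is computed from matrix
  entries, dominates the operator norm and becomes small once finitely many rows are removed.
  Removing rows has a further effect: the part split off takes values in the span of finitely many
  coordinate vectors, so the only unknowns left are the values of L_z x at those coordinates. That
  the determinant is not identically zero is seen at \<open>- \<mu>\<close>; for the isolation of
  eigenvalues the disc is chosen large enough to contain this point. The antiperiodic shift cancels
  in differences of frequencies, so one kernel estimate serves both signs.\<close>

lemma L2_set_le_l2_norm:
  assumes "x \<in> l2" "finite F"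
  shows "L2_set (\<lambda>k. cmod (x k)) F \<le> l2_norm x"
  using assms unfolding L2_set_def l2_norm_def l2_def
  by (auto intro!: real_sqrt_le_mono finite_sum_le_infsum)

text \<open>Uniform control of finite sections yields membership and norm bound at once, so the
  finite Minkowski inequality for \<open>L2_set\<close> carries over to sequences.\<close>

lemma l2_boundI:
  assumes "\<And>F. finite F \<Longrightarrow> L2_set (\<lambda>k. cmod (x k)) F \<le> C"
  shows "x \<in> l2" and "l2_norm x \<le> C"
proof -
  have C0: "0 \<le> C" using assms[of "{}"] by simp
  have le: "(\<Sum>k\<in>F. (cmod (x k))\<^sup>2) \<le> C\<^sup>2" if "finite F" for F
    using assms[OF that] C0 unfolding L2_set_def by (simp add: real_le_lsqrt sqrt_le_D)
  have s: "(\<lambda>k. (cmod (x k))\<^sup>2) summable_on UNIV"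
    by (rule nonneg_bdd_above_summable_on) (auto intro!: bdd_aboveI[of _ "C\<^sup>2"] le)
  then show "x \<in> l2" by (simp add: l2_def)
  have "infsum (\<lambda>k. (cmod (x k))\<^sup>2) UNIV \<le> C\<^sup>2"
    by (rule infsum_le_finite_sums[OF s]) (use le in auto)
  then show "l2_norm x \<le> C" unfolding l2_norm_def using C0 by (simp add: real_le_lsqrt)
qed

lemma l2_norm_nonneg [simp]: "0 \<le> l2_norm x"
  unfolding l2_norm_def by (simp add: infsum_nonneg)

lemma l2_norm_power2:
  "(l2_norm x)\<^sup>2 = infsum (\<lambda>k. (cmod (x k))\<^sup>2) UNIV"
  unfolding l2_norm_def by (simp add: infsum_nonneg)

lemma l2_component_le:
  assumes "x \<in> l2" shows "cmod (x k) \<le> l2_norm x"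
  using L2_set_le_l2_norm[OF assms, of "{k}"] by simp

lemma l2_add:
  assumes "x \<in> l2" "y \<in> l2"
  shows "(\<lambda>k. x k + y k) \<in> l2" and "l2_norm (\<lambda>k. x k + y k) \<le> l2_norm x + l2_norm y"
proof -
  have "L2_set (\<lambda>k. cmod (x k + y k)) F \<le> l2_norm x + l2_norm y" if "finite F" for F
  proof -
    have "L2_set (\<lambda>k. cmod (x k + y k)) F \<le> L2_set (\<lambda>k. cmod (x k) + cmod (y k)) F"
      by (intro L2_set_mono norm_triangle_ineq) auto
    also have "\<dots> \<le> L2_set (\<lambda>k. cmod (x k)) F + L2_set (\<lambda>k. cmod (y k)) F"
      by (rule L2_set_triangle_ineq)
    finally show ?thesis using L2_set_le_l2_norm[OF assms(1) that] L2_set_le_l2_norm[OF assms(2) that]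
      by linarith
  qed
  from l2_boundI[OF this]
  show "(\<lambda>k. x k + y k) \<in> l2" and "l2_norm (\<lambda>k. x k + y k) \<le> l2_norm x + l2_norm y" by auto
qed

lemma l2_mono:
  assumes "y \<in> l2" "\<And>k. cmod (x k) \<le> cmod (y k)"
  shows "x \<in> l2" and "l2_norm x \<le> l2_norm y"
proof -
  have "L2_set (\<lambda>k. cmod (x k)) F \<le> l2_norm y" if "finite F" for F
    using L2_set_mono[of F "\<lambda>k. cmod (x k)" "\<lambda>k. cmod (y k)"] assms(2)
      L2_set_le_l2_norm[OF assms(1) that] by fastforce
  from l2_boundI[OF this] show "x \<in> l2" and "l2_norm x \<le> l2_norm y" by auto
qed

lemma l2_scale:
  assumes "x \<in> l2"
  shows "(\<lambda>k. c * x k) \<in> l2" and "l2_norm (\<lambda>k. c * x k) = cmod c * l2_norm x"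
proof -
  show "(\<lambda>k. c * x k) \<in> l2"
    using assms unfolding l2_def by (auto simp: norm_mult power_mult_distrib intro!: summable_on_cmult_right)
  have "(l2_norm (\<lambda>k. c * x k))\<^sup>2 = (cmod c * l2_norm x)\<^sup>2"
    unfolding l2_norm_power2 power_mult_distrib
    by (simp add: norm_mult power_mult_distrib infsum_cmult_right')
  then show "l2_norm (\<lambda>k. c * x k) = cmod c * l2_norm x"
    by (subst (asm) power2_eq_iff_nonneg) auto
qed

lemma l2_diff:
  assumes "x \<in> l2" "y \<in> l2"
  shows "(\<lambda>k. x k - y k) \<in> l2" and "l2_norm (\<lambda>k. x k - y k) \<le> l2_norm x + l2_norm y"
  using l2_add[OF assms(1) l2_scale(1)[OF assms(2), of "-1"]] l2_scale(2)[OF assms(2), of "-1"] by auto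

lemma l2_zero [simp]: "(\<lambda>_. 0) \<in> l2" "l2_norm (\<lambda>_. 0) = 0"
  by (auto simp: l2_def l2_norm_def)

lemma l2_norm_eq_0:
  assumes "x \<in> l2" shows "l2_norm x = 0 \<longleftrightarrow> x = (\<lambda>_. 0)"
proof
  assume "l2_norm x = 0"
  then have "cmod (x k) \<le> 0" for k using l2_component_le[OF assms, of k] by simp
  then show "x = (\<lambda>_. 0)" by (auto simp: fun_eq_iff)
qed auto

lemma l2_sum:
  assumes "\<And>i. i \<in> P \<Longrightarrow> x i \<in> l2"
  shows "(\<lambda>k. \<Sum>i\<in>P. c i * x i k) \<in> l2"
    and "l2_norm (\<lambda>k. \<Sum>i\<in>P. c i * x i k) \<le> (\<Sum>i\<in>P. cmod (c i) * l2_norm (x i))"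
proof -
  have "(\<lambda>k. \<Sum>i\<in>P. c i * x i k) \<in> l2 \<and>
    l2_norm (\<lambda>k. \<Sum>i\<in>P. c i * x i k) \<le> (\<Sum>i\<in>P. cmod (c i) * l2_norm (x i))"
    using assms
  proof (induction P rule: infinite_finite_induct)
    case (insert p P)
    have p: "x p \<in> l2" and "\<And>i. i \<in> P \<Longrightarrow> x i \<in> l2" using insert.prems by blast+
    note IH = insert.IH[OF this(2)]
    have "(\<lambda>k. \<Sum>i\<in>insert p P. c i * x i k) = (\<lambda>k. c p * x p k + (\<Sum>i\<in>P. c i * x i k))"
      using insert.hyps by simp
    then show ?case
      using insert.hyps l2_add[OF l2_scale(1)[OF p, of "c p"] conjunct1[OF IH]]
        l2_scale(2)[OF p, of "c p"] conjunct2[OF IH] by simp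
  qed simp_all
  then show "(\<lambda>k. \<Sum>i\<in>P. c i * x i k) \<in> l2"
    and "l2_norm (\<lambda>k. \<Sum>i\<in>P. c i * x i k) \<le> (\<Sum>i\<in>P. cmod (c i) * l2_norm (x i))" by auto
qed

text \<open>Each finite section converges, so the bound survives a pointwise limit. This plays the
  part of completeness: the Neumann limit is formed componentwise and its norm is controlled
  here.\<close>

lemma l2_Fatou:
  assumes "\<And>n. x n \<in> l2" "\<And>n. n \<ge> N \<Longrightarrow> l2_norm (x n) \<le> C" "\<And>k. (\<lambda>n. x n k) \<longlonglongrightarrow> y k"
  shows "y \<in> l2" and "l2_norm y \<le> C"
proof -
  have "L2_set (\<lambda>k. cmod (y k)) F \<le> C" if "finite F" for F
  proof (rule tendsto_upperbound)
    show "(\<lambda>n. L2_set (\<lambda>k. cmod (x n k)) F) \<longlonglongrightarrow> L2_set (\<lambda>k. cmod (y k)) F"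
      unfolding L2_set_def by (intro tendsto_intros assms(3))
    show "\<forall>\<^sub>F n in sequentially. L2_set (\<lambda>k. cmod (x n k)) F \<le> C"
      using order_trans[OF L2_set_le_l2_norm[OF assms(1) that] assms(2)]
      unfolding eventually_sequentially by fast
  qed simp
  from l2_boundI[OF this] show "y \<in> l2" and "l2_norm y \<le> C" by auto
qed

lemma l2_Cauchy_Schwarz:
  assumes "x \<in> l2" "y \<in> l2"
  shows "(\<lambda>k. cmod (x k * y k)) summable_on UNIV"
    and "(\<lambda>k. x k * y k) summable_on UNIV"
    and "infsum (\<lambda>k. cmod (x k * y k)) UNIV \<le> l2_norm x * l2_norm y"
    and "cmod (infsum (\<lambda>k. x k * y k) UNIV) \<le> l2_norm x * l2_norm y"
proof -
  have le: "(\<Sum>k\<in>F. cmod (x k * y k)) \<le> l2_norm x * l2_norm y" if "finite F" for F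
  proof -
    have "(\<Sum>k\<in>F. cmod (x k * y k)) \<le> L2_set (\<lambda>k. cmod (x k)) F * L2_set (\<lambda>k. cmod (y k)) F"
      using L2_set_mult_ineq[of "\<lambda>k. cmod (x k)" "\<lambda>k. cmod (y k)" F] by (simp add: norm_mult)
    also have "\<dots> \<le> l2_norm x * l2_norm y"
      by (intro mult_mono L2_set_le_l2_norm assms that) auto
    finally show ?thesis .
  qed
  show s: "(\<lambda>k. cmod (x k * y k)) summable_on UNIV"
    by (rule nonneg_bdd_above_summable_on) (auto intro!: bdd_aboveI[of _ "l2_norm x * l2_norm y"] le)
  show "(\<lambda>k. x k * y k) summable_on UNIV"
    using s by (rule abs_summable_summable)
  show "infsum (\<lambda>k. cmod (x k * y k)) UNIV \<le> l2_norm x * l2_norm y"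
    by (rule infsum_le_finite_sums[OF s]) (use le in auto)
  then show "cmod (infsum (\<lambda>k. x k * y k) UNIV) \<le> l2_norm x * l2_norm y"
    using norm_infsum_bound[OF s] by linarith
qed

lemma l2_cnj: "x \<in> l2 \<Longrightarrow> (\<lambda>k. cnj (x k)) \<in> l2" "l2_norm (\<lambda>k. cnj (x k)) = l2_norm x"
  by (auto simp: l2_def l2_norm_def)

lemma l2_inner_summable:
  assumes "x \<in> l2" "y \<in> l2"
  shows "(\<lambda>k. x k * cnj (y k)) summable_on UNIV"
  using l2_Cauchy_Schwarz(2)[OF assms(1) l2_cnj(1)[OF assms(2)]] .

lemma l2_inner_bound:
  assumes "x \<in> l2" "y \<in> l2"
  shows "cmod (l2_inner x y) \<le> l2_norm x * l2_norm y"
  using l2_Cauchy_Schwarz(4)[OF assms(1) l2_cnj(1)[OF assms(2)]] by (simp add: l2_inner_def l2_cnj)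

lemma l2_inner_add_left:
  assumes "x \<in> l2" "y \<in> l2" "z \<in> l2"
  shows "l2_inner (\<lambda>k. x k + y k) z = l2_inner x z + l2_inner y z"
  unfolding l2_inner_def distrib_right
  by (intro infsum_add l2_inner_summable assms)

lemma l2_inner_add_right:
  assumes "x \<in> l2" "y \<in> l2" "z \<in> l2"
  shows "l2_inner z (\<lambda>k. x k + y k) = l2_inner z x + l2_inner z y"
  unfolding l2_inner_def distrib_left complex_cnj_add
  by (intro infsum_add l2_inner_summable assms)

lemma l2_inner_scale_left: "l2_inner (\<lambda>k. c * x k) z = c * l2_inner x z"
  unfolding l2_inner_def mult.assoc by (rule infsum_cmult_right')

lemma l2_inner_scale_right: "l2_inner z (\<lambda>k. c * x k) = cnj c * l2_inner z x"
  unfolding l2_inner_def by (simp add: mult.left_commute infsum_cmult_right')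

lemma l2_inner_diff_left:
  assumes "x \<in> l2" "y \<in> l2" "z \<in> l2"
  shows "l2_inner (\<lambda>k. x k - y k) z = l2_inner x z - l2_inner y z"
  using l2_inner_add_left[OF assms(1) l2_scale(1)[OF assms(2), of "-1"] assms(3)]
    l2_inner_scale_left[of "-1" y z] by simp

lemma l2_inner_diff_right:
  assumes "x \<in> l2" "y \<in> l2" "z \<in> l2"
  shows "l2_inner z (\<lambda>k. x k - y k) = l2_inner z x - l2_inner z y"
  using l2_inner_add_right[OF assms(1) l2_scale(1)[OF assms(2), of "-1"] assms(3)]
    l2_inner_scale_right[of z "-1" y] by simp

lemma l2_inner_self:
  assumes "x \<in> l2" shows "l2_inner x x = complex_of_real ((l2_norm x)\<^sup>2)"
proof -
  have "((\<lambda>k. (cmod (x k))\<^sup>2) has_sum (l2_norm x)\<^sup>2) UNIV"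
    unfolding l2_norm_power2 using assms by (simp add: l2_def)
  then have "((\<lambda>k. complex_of_real ((cmod (x k))\<^sup>2)) has_sum complex_of_real ((l2_norm x)\<^sup>2)) UNIV"
    by (subst has_sum_of_real_iff)
  then show ?thesis unfolding l2_inner_def complex_norm_square by (rule infsumI)
qed

definition e_seq :: "int \<Rightarrow> seq" where
  "e_seq i = (\<lambda>k. if k = i then 1 else 0)"

lemma infsum_single_int:
  fixes f :: "int \<Rightarrow> complex"
  assumes "\<And>j. j \<noteq> i \<Longrightarrow> f j = 0" shows "infsum f UNIV = f i"
  using infsum_cong_neutral[of UNIV "{i}" f f] assms by auto

lemma e_seq_l2: "e_seq i \<in> l2" "l2_norm (e_seq i) = 1"
proof -
  have "(\<lambda>k. (cmod (e_seq i k))\<^sup>2) summable_on UNIV"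
    by (rule finite_nonzero_values_imp_summable_on) (simp add: e_seq_def)
  then show l: "e_seq i \<in> l2" by (simp add: l2_def)
  have "complex_of_real ((l2_norm (e_seq i))\<^sup>2) = 1"
    unfolding l2_inner_self[OF l, symmetric] l2_inner_def
    by (subst infsum_single_int[of i]) (auto simp: e_seq_def)
  then have "(l2_norm (e_seq i))\<^sup>2 = 1" by (metis of_real_eq_1_iff)
  then show "l2_norm (e_seq i) = 1" using l2_norm_nonneg[of "e_seq i"]
    by (metis abs_of_nonneg real_sqrt_abs real_sqrt_one)
qed

text \<open>Allowing every \<open>Q\<close> above \<open>P\<close> gives one threshold for a whole
  increasing family of truncations, as uniform convergence of partial sums requires.\<close>

lemma l2_tail:
  assumes "x \<in> l2" "\<epsilon> > 0"
  obtains P where "finite P"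
    "\<And>Q. P \<subseteq> Q \<Longrightarrow> l2_norm (\<lambda>k. if k \<in> Q then 0 else x k) < \<epsilon>"
proof -
  let ?f = "\<lambda>k. (cmod (x k))\<^sup>2"
  have s: "?f summable_on UNIV" using assms by (simp add: l2_def)
  have "\<epsilon>\<^sup>2/2 > 0" using assms by simp
  then obtain P where P: "finite P" "dist (sum ?f P) (infsum ?f UNIV) \<le> \<epsilon>\<^sup>2/2"
    using infsum_finite_approximation[OF s, of "\<epsilon>\<^sup>2/2"] by blast
  have "l2_norm (\<lambda>k. if k \<in> Q then 0 else x k) < \<epsilon>" if Q: "P \<subseteq> Q" for Q
  proof -
    have sQ: "?f summable_on - P" by (rule summable_on_subset[OF s]) auto
    have eq: "infsum ?f UNIV = sum ?f P + infsum ?f (- P)"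
      using infsum_Un_disjoint[of ?f P "-P"] P(1) sQ by (simp add: summable_on_finite)
    have "(l2_norm (\<lambda>k. if k \<in> Q then 0 else x k))\<^sup>2 \<le> infsum ?f (- P)"
      unfolding l2_norm_power2
    proof (rule infsum_mono_neutral)
      show "(\<lambda>k. (cmod (if k \<in> Q then 0 else x k))\<^sup>2) summable_on UNIV"
        by (rule summable_on_comparison_test[OF s]) auto
    qed (use sQ Q in auto)
    also have "\<dots> < \<epsilon>\<^sup>2"
      using P(2) eq \<open>\<epsilon>\<^sup>2/2 > 0\<close> unfolding dist_real_def by linarith
    finally show ?thesis 
      by (rule power2_less_imp_less) (use assms(2) in simp)
  qed
  then show thesis by (rule that[OF P(1)])
qed

section \<open>Hilbert--Schmidt matrices\<close>

type_synonym kernel = "int \<Rightarrow> int \<Rightarrow> complex"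

text \<open>Complex-valued, so that the row norms form a \<open>seq\<close> again and the
  Hilbert-Schmidt norm becomes an \<open>l2_norm\<close> to which the sequence lemmas apply.\<close>

definition row_norm :: "kernel \<Rightarrow> seq" where
  "row_norm a = (\<lambda>k. complex_of_real (l2_norm (a k)))"

definition hs :: "kernel \<Rightarrow> bool" where
  "hs a \<longleftrightarrow> (\<forall>k. a k \<in> l2) \<and> row_norm a \<in> l2"

definition hs_norm :: "kernel \<Rightarrow> real" where
  "hs_norm a = l2_norm (row_norm a)"

definition app :: "kernel \<Rightarrow> seq \<Rightarrow> seq" where
  "app a x = (\<lambda>k. infsum (\<lambda>j. a k j * x j) UNIV)"

lemma hs_norm_nonneg [simp]: "0 \<le> hs_norm a"
  by (simp add: hs_norm_def)

lemma app_component_le: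
  assumes "hs a" "x \<in> l2" shows "cmod (app a x k) \<le> l2_norm (a k) * l2_norm x"
  using assms unfolding app_def hs_def by (auto intro: l2_Cauchy_Schwarz)

lemma app_l2:
  assumes "hs a" "x \<in> l2"
  shows "app a x \<in> l2" and "l2_norm (app a x) \<le> hs_norm a * l2_norm x"
proof -
  have l: "row_norm a \<in> l2" using assms by (simp add: hs_def)
  have "cmod (app a x k) \<le> cmod (complex_of_real (l2_norm x) * row_norm a k)" for k
    using app_component_le[OF assms] by (simp add: row_norm_def norm_mult mult.commute)
  from l2_mono[OF l2_scale(1)[OF l] this]
  show "app a x \<in> l2" and "l2_norm (app a x) \<le> hs_norm a * l2_norm x"
    using l2_scale(2)[OF l, of "complex_of_real (l2_norm x)"]
    by (auto simp: hs_norm_def mult.commute)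
qed

lemma app_add:
  assumes "hs a" "x \<in> l2" "y \<in> l2"
  shows "app a (\<lambda>k. x k + y k) = (\<lambda>k. app a x k + app a y k)"
  unfolding app_def distrib_left
  by (intro ext infsum_add l2_Cauchy_Schwarz assms) (use assms in \<open>auto simp: hs_def\<close>)

lemma app_scale: "app a (\<lambda>k. c * x k) = (\<lambda>k. c * app a x k)"
  unfolding app_def by (simp add: mult.left_commute infsum_cmult_right')

lemma app_zero: "app a (\<lambda>_. 0) = (\<lambda>_. 0)"
  by (simp add: app_def)

lemma app_diff:
  assumes "hs a" "x \<in> l2" "y \<in> l2"
  shows "app a (\<lambda>k. x k - y k) = (\<lambda>k. app a x k - app a y k)"
  using app_add[OF assms(1,2) l2_scale(1)[OF assms(3), of "-1"]] app_scale[of a "-1" y] by simp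

lemma app_sum:
  assumes "hs a" "\<And>i. i \<in> P \<Longrightarrow> x i \<in> l2"
  shows "app a (\<lambda>k. \<Sum>i\<in>P. c i * x i k) = (\<lambda>k. \<Sum>i\<in>P. c i * app a (x i) k)"
  using assms(2)
proof (induction P rule: infinite_finite_induct)
  case (insert p P)
  have p: "x p \<in> l2" and P: "\<And>i. i \<in> P \<Longrightarrow> x i \<in> l2" using insert.prems by blast+
  have "(\<lambda>k. \<Sum>i\<in>insert p P. c i * x i k) = (\<lambda>k. c p * x p k + (\<Sum>i\<in>P. c i * x i k))"
    using insert.hyps by simp
  then show ?case
    using insert.hyps insert.IH[OF P] app_add[OF assms(1) l2_scale(1)[OF p, of "c p"] l2_sum(1)[of P x c, OF P]]
    by (simp add: app_scale)
qed (simp_all add: app_zero)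

lemma hs_mono:
  assumes "hs b" "\<And>k j. cmod (a k j) \<le> cmod (b k j)"
  shows "hs a" and "hs_norm a \<le> hs_norm b"
proof -
  have 1: "a k \<in> l2" "l2_norm (a k) \<le> l2_norm (b k)" for k
    using l2_mono[of "b k" "a k"] assms by (auto simp: hs_def)
  have 2: "cmod (row_norm a k) \<le> cmod (row_norm b k)" for k
    using 1 by (simp add: row_norm_def)
  have 3: "row_norm b \<in> l2" using assms by (simp add: hs_def)
  show "hs a" "hs_norm a \<le> hs_norm b"
    using l2_mono[OF 3 2] 1 by (auto simp: hs_def hs_norm_def)
qed

lemma hs_add:
  assumes "hs a" "hs b"
  shows "hs (\<lambda>k j. a k j + b k j)"
proof -
  have 1: "a k \<in> l2" "b k \<in> l2" for k using assms by (auto simp: hs_def)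
  have "(\<lambda>k. row_norm a k + row_norm b k) \<in> l2"
    using assms by (intro l2_add) (auto simp: hs_def)
  moreover have "cmod (row_norm (\<lambda>k j. a k j + b k j) k) \<le> cmod (row_norm a k + row_norm b k)" for k
  proof -
    have "cmod (row_norm a k + row_norm b k) = l2_norm (a k) + l2_norm (b k)"
      unfolding row_norm_def of_real_add[symmetric] norm_of_real by simp
    then show ?thesis using l2_add(2)[OF 1[of k]] by (simp add: row_norm_def)
  qed
  ultimately have "row_norm (\<lambda>k j. a k j + b k j) \<in> l2" by (rule l2_mono)
  then show ?thesis using l2_add(1)[OF 1] by (auto simp: hs_def)
qed

lemma hs_scale:
  assumes "hs a" shows "hs (\<lambda>k j. c * a k j)"
proof -
  have "row_norm (\<lambda>k j. c * a k j) = (\<lambda>k. complex_of_real (cmod c) * row_norm a k)"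
    using assms by (auto simp: row_norm_def hs_def l2_scale(2))
  then show ?thesis using assms by (auto simp: hs_def l2_scale(1))
qed

lemma hs_mask:
  assumes "hs a" shows "hs (\<lambda>k j. if k \<in> P then 0 else a k j)"
  by (rule hs_mono[OF assms]) auto

lemma hs_tail:
  assumes "hs a" "\<epsilon> > 0"
  obtains P where "finite P" "hs_norm (\<lambda>k j. if k \<in> P then 0 else a k j) < \<epsilon>"
proof -
  have "row_norm a \<in> l2" using assms by (simp add: hs_def)
  from l2_tail[OF this assms(2)] obtain P
    where P: "finite P" "l2_norm (\<lambda>k. if k \<in> P then 0 else row_norm a k) < \<epsilon>"
    using order_refl by metis
  have "row_norm (\<lambda>k j. if k \<in> P then 0 else a k j) = (\<lambda>k. if k \<in> P then 0 else row_norm a k)"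
    by (auto simp: row_norm_def)
  then show thesis using that P by (simp add: hs_norm_def)
qed

text \<open>The double series converges absolutely: Cauchy-Schwarz in each row bounds the row sum by
  \<open>l2_norm x\<close> times the product of row norm and \<open>y k\<close>, and a second
  Cauchy-Schwarz sums these. This licenses the exchange of summations.\<close>

lemma app_adjoint:
  assumes "hs a" "x \<in> l2" "y \<in> l2"
  shows "l2_inner (app a x) y = l2_inner x (app (\<lambda>k j. cnj (a j k)) y)"
proof -
  let ?f = "\<lambda>k j. a k j * x j * cnj (y k)"
  have row: "(\<lambda>j. cmod (?f k j)) summable_on UNIV" for k
    using summable_on_cmult_left[OF l2_Cauchy_Schwarz(1)[of "a k" x], of "cmod (y k)"] assms
    by (simp add: hs_def norm_mult)
  have rowle: "infsum (\<lambda>j. cmod (?f k j)) UNIV \<le> l2_norm x * cmod (row_norm a k * y k)" for k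
  proof -
    have "infsum (\<lambda>j. cmod (?f k j)) UNIV = infsum (\<lambda>j. cmod (a k j * x j)) UNIV * cmod (y k)"
      by (subst infsum_cmult_left'[symmetric]) (simp add: norm_mult)
    also have "\<dots> \<le> (l2_norm (a k) * l2_norm x) * cmod (y k)"
      using assms by (intro mult_right_mono l2_Cauchy_Schwarz) (auto simp: hs_def)
    finally show ?thesis by (simp add: row_norm_def norm_mult mult_ac)
  qed
  have "(\<lambda>k. infsum (\<lambda>j. cmod (?f k j)) UNIV) summable_on UNIV"
  proof (rule summable_on_comparison_test)
    show "(\<lambda>k. l2_norm x * cmod (row_norm a k * y k)) summable_on UNIV"
      using assms by (intro summable_on_cmult_right l2_Cauchy_Schwarz) (auto simp: hs_def)
  qed (use rowle in \<open>auto intro: infsum_nonneg\<close>)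
  then have "(\<lambda>p. cmod (case p of (k, j) \<Rightarrow> ?f k j)) summable_on (UNIV \<times> UNIV)"
    using row by (intro summable_on_SigmaI[where g="\<lambda>k. infsum (\<lambda>j. cmod (?f k j)) UNIV"])
      (auto intro: has_sum_infsum)
  then have "(\<lambda>(k, j). ?f k j) summable_on (UNIV \<times> UNIV)"
    by (rule abs_summable_summable)
  from infsum_swap_banach[OF this]
  have sw: "(\<Sum>\<^sub>\<infinity>k. \<Sum>\<^sub>\<infinity>j. ?f k j) = (\<Sum>\<^sub>\<infinity>j. \<Sum>\<^sub>\<infinity>k. ?f k j)" .
  have "l2_inner (app a x) y = (\<Sum>\<^sub>\<infinity>k. \<Sum>\<^sub>\<infinity>j. ?f k j)"
    unfolding l2_inner_def app_def by (simp add: infsum_cmult_left')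
  also have "\<dots> = (\<Sum>\<^sub>\<infinity>j. x j * cnj (\<Sum>\<^sub>\<infinity>k. cnj (a k j) * y k))"
    unfolding sw
  proof (rule infsum_cong)
    fix j
    have "(\<Sum>\<^sub>\<infinity>k. ?f k j) = (\<Sum>\<^sub>\<infinity>k. x j * cnj (cnj (a k j) * y k))"
      by (rule infsum_cong) simp
    also have "\<dots> = x j * cnj (\<Sum>\<^sub>\<infinity>k. cnj (a k j) * y k)"
      unfolding infsum_cmult_right' infsum_cnj ..
    finally show "(\<Sum>\<^sub>\<infinity>k. ?f k j) = x j * cnj (\<Sum>\<^sub>\<infinity>k. cnj (a k j) * y k)" .
  qed
  finally show ?thesis by (simp add: l2_inner_def app_def)
qed

section \<open>Holomorphic matrix inversion\<close>

lemma holomorphic_on_det: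
  assumes "\<And>z. M z \<in> carrier_mat n n"
    and "\<And>i j. i < n \<Longrightarrow> j < n \<Longrightarrow> (\<lambda>z. M z $$ (i, j)) holomorphic_on S"
  shows "(\<lambda>z. Determinant.det (M z)) holomorphic_on S"
proof -
  have "Determinant.det (M z) =
      (\<Sum>p | p permutes {0..<n}. of_int (sign p) * (\<Prod>i = 0..<n. M z $$ (i, p i)))" for z
    using assms(1)[of z] by (auto simp: Determinant.det_def)
  moreover have "(\<lambda>z. M z $$ (i, p i)) holomorphic_on S"
    if "p permutes {0..<n}" "i \<in> {0..<n}" for p i
    using assms(2)[of i "p i"] that permutes_in_image[OF that(1), of i] by auto
  ultimately show ?thesis
    by (auto intro!: holomorphic_intros)
qed

text \<open>\<open>\<Delta>\<close> is the determinant and \<open>A\<close> the adjugate, both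
  polynomial in the entries. The identity with \<open>A\<close> on the left recovers a given
  solution of the linear system, the one with \<open>A\<close> on the right produces a solution, and
  the last clause supplies a kernel vector at a zero of \<open>\<Delta>\<close>.\<close>

lemma holomorphic_Cramer_nat:
  fixes F :: "complex \<Rightarrow> nat \<Rightarrow> nat \<Rightarrow> complex"
  assumes "\<And>i j. i < n \<Longrightarrow> j < n \<Longrightarrow> (\<lambda>z. F z i j) holomorphic_on S"
  obtains \<Delta> A where "\<Delta> holomorphic_on S"
    "\<And>i j. i < n \<Longrightarrow> j < n \<Longrightarrow> (\<lambda>z. A z i j) holomorphic_on S"
    "\<And>z i k. i < n \<Longrightarrow> k < n \<Longrightarrow> (\<Sum>j<n. A z i j * F z j k) = (if i = k then \<Delta> z else 0)"
    "\<And>z i k. i < n \<Longrightarrow> k < n \<Longrightarrow> (\<Sum>j<n. F z i j * A z j k) = (if i = k then \<Delta> z else 0)"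
    "\<And>z. \<Delta> z = 0 \<Longrightarrow> \<exists>y. (\<exists>i<n. y i \<noteq> 0) \<and> (\<forall>i<n. (\<Sum>j<n. F z i j * y j) = 0)"
proof -
  define M where "M z = Matrix.mat n n (\<lambda>(i, j). F z i j)" for z
  have M: "M z \<in> carrier_mat n n" for z by (simp add: M_def)
  have Mij: "M z $$ (i, j) = F z i j" if "i < n" "j < n" for z i j
    using that by (simp add: M_def)
  define \<Delta> where "\<Delta> z = Determinant.det (M z)" for z
  define A where "A z i j = adj_mat (M z) $$ (i, j)" for z i j
  have adj: "adj_mat (M z) \<in> carrier_mat n n" for z using adj_mat(1)[OF M] .
  have prod: "(B * C) $$ (i, k) = (\<Sum>j<n. B $$ (i, j) * C $$ (j, k))"
    if "B \<in> carrier_mat n n" "C \<in> carrier_mat n n" "i < n" "k < n" for B C :: "complex mat" and i k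
    using that by (simp add: scalar_prod_def atLeast0LessThan)
  show thesis
  proof (rule that[of \<Delta> A])
    show "\<Delta> holomorphic_on S" unfolding \<Delta>_def
      by (rule holomorphic_on_det[OF M]) (simp add: Mij assms)
    show "(\<lambda>z. A z i j) holomorphic_on S" if "i < n" "j < n" for i j
    proof -
      have "A z i j = (-1) ^ (j + i) * Determinant.det (mat_delete (M z) j i)" for z
        using that M[of z] by (simp add: A_def adj_mat_def cofactor_def)
      moreover have "(\<lambda>z. Determinant.det (mat_delete (M z) j i)) holomorphic_on S"
        by (rule holomorphic_on_det[of _ "n - 1"])
          (use that in \<open>auto simp: mat_delete_def M_def intro!: assms\<close>)
      ultimately show ?thesis by (auto intro!: holomorphic_intros)
    qed
    show "(\<Sum>j<n. A z i j * F z j k) = (if i = k then \<Delta> z else 0)" if "i < n" "k < n" for z i k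
    proof -
      have "(\<Sum>j<n. A z i j * F z j k) = (adj_mat (M z) * M z) $$ (i, k)"
        unfolding prod[OF adj M that] using that by (simp add: A_def Mij)
      then show ?thesis unfolding adj_mat(3)[OF M] using that by (auto simp: \<Delta>_def)
    qed
    show "(\<Sum>j<n. F z i j * A z j k) = (if i = k then \<Delta> z else 0)" if "i < n" "k < n" for z i k
    proof -
      have "(\<Sum>j<n. F z i j * A z j k) = (M z * adj_mat (M z)) $$ (i, k)"
        unfolding prod[OF M adj that] using that by (simp add: A_def Mij)
      then show ?thesis unfolding adj_mat(2)[OF M] using that by (auto simp: \<Delta>_def)
    qed
    show "\<exists>y. (\<exists>i<n. y i \<noteq> 0) \<and> (\<forall>i<n. (\<Sum>j<n. F z i j * y j) = 0)" if "\<Delta> z = 0" for z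
    proof -
      obtain v where v: "v \<in> carrier_vec n" "v \<noteq> 0\<^sub>v n" "M z *\<^sub>v v = 0\<^sub>v n"
        using \<open>\<Delta> z = 0\<close> det_0_iff_vec_prod_zero[OF M, of z] by (auto simp: \<Delta>_def)
      have "\<exists>i<n. vec_index v i \<noteq> 0" using v(1,2) by (auto simp: vec_eq_iff)
      moreover have "(\<Sum>j<n. F z i j * vec_index v j) = 0" if "i < n" for i
      proof -
        have "(\<Sum>j<n. F z i j * vec_index v j) = vec_index (M z *\<^sub>v v) i"
          using v(1) that M[of z] by (simp add: scalar_prod_def atLeast0LessThan Mij)
        then show ?thesis using v(3) that by simp
      qed
      ultimately show ?thesis by blast
    qed
  qed
qed

text \<open>Transport along an enumeration of \<open>P\<close>, because the finite systems below are
  indexed by sets of integers.\<close>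

lemma holomorphic_Cramer:
  fixes F :: "complex \<Rightarrow> 'a \<Rightarrow> 'a \<Rightarrow> complex"
  assumes "finite P" "\<And>i j. i \<in> P \<Longrightarrow> j \<in> P \<Longrightarrow> (\<lambda>z. F z i j) holomorphic_on S"
  obtains \<Delta> A where "\<Delta> holomorphic_on S"
    "\<And>i j. i \<in> P \<Longrightarrow> j \<in> P \<Longrightarrow> (\<lambda>z. A z i j) holomorphic_on S"
    "\<And>z i k. i \<in> P \<Longrightarrow> k \<in> P \<Longrightarrow> (\<Sum>j\<in>P. A z i j * F z j k) = (if i = k then \<Delta> z else 0)"
    "\<And>z i k. i \<in> P \<Longrightarrow> k \<in> P \<Longrightarrow> (\<Sum>j\<in>P. F z i j * A z j k) = (if i = k then \<Delta> z else 0)"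
    "\<And>z. \<Delta> z = 0 \<Longrightarrow> \<exists>y. (\<exists>i\<in>P. y i \<noteq> 0) \<and> (\<forall>i\<in>P. (\<Sum>j\<in>P. F z i j * y j) = 0)"
proof -
  define n where "n = card P"
  obtain h where h: "bij_betw h {..<n} P"
    using ex_bij_betw_nat_finite[OF assms(1)] by (auto simp: n_def atLeast0LessThan)
  define g where "g = the_inv_into {..<n} h"
  have gP: "g i < n" "h (g i) = i" if "i \<in> P" for i
    using that h the_inv_into_into[of h "{..<n}" i "{..<n}"]
    by (simp_all add: g_def bij_betw_def f_the_inv_into_f)
  have hP: "h i \<in> P" "g (h i) = i" if "i < n" for i
    using that h by (auto simp: g_def bij_betw_def the_inv_into_f_f)
  have sum_h: "(\<Sum>j\<in>P. f j) = (\<Sum>j<n. f (h j))" for f :: "'a \<Rightarrow> complex"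
    using sum.reindex_bij_betw[OF h, of f] by simp
  have "(\<lambda>z. F z (h i) (h j)) holomorphic_on S" if "i < n" "j < n" for i j
    using that by (intro assms(2) hP)
  note hol = this
  obtain \<Delta> A where C: "\<Delta> holomorphic_on S"
    "\<And>i j. i < n \<Longrightarrow> j < n \<Longrightarrow> (\<lambda>z. A z i j) holomorphic_on S"
    "\<And>z i k. i < n \<Longrightarrow> k < n \<Longrightarrow> (\<Sum>j<n. A z i j * F z (h j) (h k)) = (if i = k then \<Delta> z else 0)"
    "\<And>z i k. i < n \<Longrightarrow> k < n \<Longrightarrow> (\<Sum>j<n. F z (h i) (h j) * A z j k) = (if i = k then \<Delta> z else 0)"
    "\<And>z. \<Delta> z = 0 \<Longrightarrow> \<exists>y. (\<exists>i<n. y i \<noteq> 0) \<and> (\<forall>i<n. (\<Sum>j<n. F z (h i) (h j) * y j) = 0)"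
    by (rule holomorphic_Cramer_nat[of n "\<lambda>z i j. F z (h i) (h j)" S, OF hol], assumption+)
      (rule that, assumption+)
  have inj: "g i = g k \<longleftrightarrow> i = k" if "i \<in> P" "k \<in> P" for i k
    using gP(2)[OF that(1)] gP(2)[OF that(2)] by metis
  show thesis
  proof (rule that[of \<Delta> "\<lambda>z i j. A z (g i) (g j)"])
    show "\<Delta> holomorphic_on S" by fact
    show "(\<lambda>z. A z (g i) (g j)) holomorphic_on S" if "i \<in> P" "j \<in> P" for i j
      using that by (intro C(2) gP)
    show "(\<Sum>j\<in>P. A z (g i) (g j) * F z j k) = (if i = k then \<Delta> z else 0)"
      if "i \<in> P" "k \<in> P" for z i k
      using C(3)[OF gP(1) gP(1), OF that, of z] that by (simp add: sum_h hP gP inj)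
    show "(\<Sum>j\<in>P. F z i j * A z (g j) (g k)) = (if i = k then \<Delta> z else 0)"
      if "i \<in> P" "k \<in> P" for z i k
      using C(4)[OF gP(1) gP(1), OF that, of z] that by (simp add: sum_h hP gP inj)
    show "\<exists>y. (\<exists>i\<in>P. y i \<noteq> 0) \<and> (\<forall>i\<in>P. (\<Sum>j\<in>P. F z i j * y j) = 0)" if "\<Delta> z = 0" for z
    proof -
      obtain y i where y: "i < n" "y i \<noteq> 0" "\<And>i. i < n \<Longrightarrow> (\<Sum>j<n. F z (h i) (h j) * y j) = 0"
        using C(5)[OF \<open>\<Delta> z = 0\<close>] by blast
      have "(\<Sum>j\<in>P. F z i j * y (g j)) = 0" if "i \<in> P" for i
        using y(3)[OF gP(1)[OF that]] that by (simp add: sum_h hP gP)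
      moreover have "\<exists>i\<in>P. y (g i) \<noteq> 0" using y(2) hP[OF y(1)] by (intro bexI[of _ "h i"]) simp_all
      ultimately show ?thesis by (intro exI[of _ "\<lambda>i. y (g i)"] conjI ballI)
    qed
  qed
qed

section \<open>Analytic Fredholm theory for affine families\<close>

definition aff :: "kernel \<Rightarrow> kernel \<Rightarrow> complex \<Rightarrow> kernel" where
  "aff A B z = (\<lambda>k j. A k j + z * B k j)"

text \<open>An entrywise majorant of \<open>aff A B z\<close> for all z with modulus at most
  \<open>\<rho>\<close>. Truncating it once makes the truncation work uniformly on the disc.\<close>

definition maj :: "kernel \<Rightarrow> kernel \<Rightarrow> real \<Rightarrow> kernel" where
  "maj A B \<rho> = (\<lambda>k j. complex_of_real (cmod (A k j)) + complex_of_real \<rho> * complex_of_real (cmod (B k j)))"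

lemma hs_aff: "hs A \<Longrightarrow> hs B \<Longrightarrow> hs (aff A B z)"
  unfolding aff_def by (intro hs_add hs_scale)

lemma hs_maj:
  assumes "hs A" "hs B" shows "hs (maj A B \<rho>)"
  unfolding maj_def
  by (intro hs_add hs_scale) (rule hs_mono[OF assms(1)] hs_mono[OF assms(2)], simp)+

lemma aff_le_maj:
  assumes "cmod z \<le> \<rho>" shows "cmod (aff A B z k j) \<le> cmod (maj A B \<rho> k j)"
proof -
  have r: "0 \<le> \<rho>" using assms norm_ge_zero order_trans by blast
  have "cmod (aff A B z k j) \<le> cmod (A k j) + cmod z * cmod (B k j)"
    unfolding aff_def by (metis norm_mult norm_triangle_ineq)
  also have "\<dots> \<le> cmod (A k j) + \<rho> * cmod (B k j)"
    using assms by (intro add_left_mono mult_right_mono) auto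
  also have "\<dots> = cmod (maj A B \<rho> k j)"
    unfolding maj_def of_real_mult[symmetric] of_real_add[symmetric] norm_of_real
    using r by simp
  finally show ?thesis .
qed

text \<open>Symmetric partial sums are holomorphic, and they converge uniformly: the remainder is at
  most the tail of row \<open>k\<close> of the majorant times the uniform bound on
  \<open>g z\<close>.\<close>

lemma holomorphic_app_aff:
  assumes hs: "hs A" "hs B"
    and hol: "\<And>j. (\<lambda>z. g z j) holomorphic_on ball 0 \<rho>"
    and g: "\<And>z. z \<in> ball 0 \<rho> \<Longrightarrow> g z \<in> l2" "\<And>z. z \<in> ball 0 \<rho> \<Longrightarrow> l2_norm (g z) \<le> C"
  shows "(\<lambda>z. app (aff A B z) (g z) k) holomorphic_on ball 0 \<rho>"
proof (rule holomorphic_uniform_sequence)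
  let ?I = "\<lambda>n::nat. {- int n..int n}"
  let ?f = "\<lambda>n z. \<Sum>j\<in>?I n. aff A B z k j * g z j"
  show "open (ball (0::complex) \<rho>)" by simp
  show "?f n holomorphic_on ball 0 \<rho>" for n
    unfolding aff_def by (intro holomorphic_intros hol)
  have unif: "uniform_limit (ball 0 \<rho>) ?f (\<lambda>z. app (aff A B z) (g z) k) sequentially"
  proof (rule uniform_limitI)
    fix \<epsilon> :: real assume \<epsilon>: "\<epsilon> > 0"
    \<comment> \<open>\<open>C\<close> may be zero; enlarging it gives a positive divisor for the
      tail tolerance.\<close>
    define C' where "C' = max C 0 + 1"
    have C': "C' > 0" "C \<le> C'" by (auto simp: C'_def)
    have mk: "maj A B \<rho> k \<in> l2" using hs_maj[OF hs] by (simp add: hs_def)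
    obtain P where P: "finite P"
      "\<And>Q. P \<subseteq> Q \<Longrightarrow> l2_norm (\<lambda>j. if j \<in> Q then 0 else maj A B \<rho> k j) < \<epsilon> / C'"
      by (rule l2_tail[OF mk, of "\<epsilon> / C'"]) (use \<epsilon> C' in auto)
    obtain N where N: "P \<subseteq> ?I N"
    proof -
      obtain b where "\<And>j. j \<in> P \<Longrightarrow> \<bar>j\<bar> \<le> b"
        using finite_imageI[OF P(1), of abs] by (metis Max_ge imageI)
      then have "P \<subseteq> ?I (nat b)" by force
      then show thesis by (rule that)
    qed
    have "dist (?f n z) (app (aff A B z) (g z) k) < \<epsilon>" if n: "n \<ge> N" and z: "z \<in> ball 0 \<rho>" for n z
    proof -
      let ?t = "\<lambda>j. if j \<in> ?I n then 0 else aff A B z k j"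
      have zr: "cmod z \<le> \<rho>" using z by simp
      have ak: "aff A B z k \<in> l2" using hs_aff[OF hs] by (simp add: hs_def)
      have mask: "(\<lambda>j. if j \<in> ?I n then 0 else maj A B \<rho> k j) \<in> l2"
        by (rule l2_mono[OF mk]) auto
      have t: "?t \<in> l2" "l2_norm ?t \<le> l2_norm (\<lambda>j. if j \<in> ?I n then 0 else maj A B \<rho> k j)"
        by (rule l2_mono[OF mask]; use aff_le_maj[OF zr] in auto)+
      have "l2_norm (\<lambda>j. if j \<in> ?I n then 0 else maj A B \<rho> k j) < \<epsilon> / C'"
        by (rule P(2)) (use N n in force)
      then have t': "l2_norm ?t < \<epsilon> / C'" using t(2) by linarith
      have "app (aff A B z) (g z) k =
          infsum (\<lambda>j. (if j \<in> ?I n then aff A B z k j * g z j else 0) + ?t j * g z j) UNIV"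
        unfolding app_def by (rule infsum_cong) auto
      also have "\<dots> = infsum (\<lambda>j. if j \<in> ?I n then aff A B z k j * g z j else 0) UNIV
          + infsum (\<lambda>j. ?t j * g z j) UNIV"
        by (intro infsum_add l2_Cauchy_Schwarz t g z finite_nonzero_values_imp_summable_on)
          (rule finite_subset[of _ "?I n"], auto)
      also have "infsum (\<lambda>j. if j \<in> ?I n then aff A B z k j * g z j else 0) UNIV
          = infsum (\<lambda>j. aff A B z k j * g z j) (?I n)"
        by (rule infsum_cong_neutral) auto
      finally have "app (aff A B z) (g z) k - ?f n z = infsum (\<lambda>j. ?t j * g z j) UNIV"
        by simp
      then have "cmod (app (aff A B z) (g z) k - ?f n z) \<le> l2_norm ?t * l2_norm (g z)"
        using l2_Cauchy_Schwarz(4)[OF t(1) g(1)[OF z]] by simp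
      also have "\<dots> \<le> l2_norm ?t * C'"
        using g(2)[OF z] C' by (intro mult_left_mono) auto
      also have "\<dots> < \<epsilon> / C' * C'" using t' C'(1) by (intro mult_strict_right_mono)
      finally show ?thesis using C'(1) by (simp add: dist_norm norm_minus_commute)
    qed
    then show "\<forall>\<^sub>F n in sequentially. \<forall>z\<in>ball 0 \<rho>. dist (?f n z) (app (aff A B z) (g z) k) < \<epsilon>"
      unfolding eventually_sequentially by blast
  qed
  show "\<exists>d>0. cball z d \<subseteq> ball 0 \<rho> \<and>
      uniform_limit (cball z d) ?f (\<lambda>z. app (aff A B z) (g z) k) sequentially"
    if "z \<in> ball 0 \<rho>" for z
  proof -
    obtain d where d: "d > 0" "cball z d \<subseteq> ball 0 \<rho>"
      using \<open>z \<in> ball 0 \<rho>\<close> open_contains_cball[of "ball 0 \<rho>"] by (meson open_ball)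
    then show ?thesis using uniform_limit_on_subset[OF unif] by blast
  qed
qed

subsection \<open>Neumann series\<close>

primrec niter :: "kernel \<Rightarrow> seq \<Rightarrow> nat \<Rightarrow> seq" where
  "niter a g 0 = g"
| "niter a g (Suc n) = (\<lambda>k. g k + app a (niter a g n) k)"

text \<open>The value of (I - a)^(-1) at \<open>g\<close>, since \<open>niter a g n\<close> is the
  Neumann partial sum of a^p g over p \<le> n. Taking the limit componentwise lets holomorphy in a
  parameter be checked one component at a time.\<close>

definition nsol :: "kernel \<Rightarrow> seq \<Rightarrow> seq" where
  "nsol a g = (\<lambda>k. lim (\<lambda>n. niter a g n k))"

context
  fixes a :: kernel and g :: seq
  assumes a: "hs a" "hs_norm a \<le> 1 / 2" and g: "g \<in> l2"
begin

lemma app_half: "x \<in> l2 \<Longrightarrow> l2_norm (app a x) \<le> 1 / 2 * l2_norm x"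
  using app_l2(2)[OF a(1), of x] mult_right_mono[OF a(2), of "l2_norm x"] by simp

lemma niter_l2: "niter a g n \<in> l2"
  by (induction n) (auto intro!: g l2_add app_l2 a)

lemma niter_step: "l2_norm (\<lambda>k. niter a g (Suc n) k - niter a g n k) \<le> (1/2) ^ Suc n * l2_norm g"
proof (induction n)
  case 0
  then show ?case using app_half[OF g] by simp
next
  case (Suc n)
  let ?d = "\<lambda>k. niter a g (Suc n) k - niter a g n k"
  have "(\<lambda>k. niter a g (Suc (Suc n)) k - niter a g (Suc n) k) = app a ?d"
    by (subst app_diff[OF a(1) niter_l2 niter_l2]) simp
  then have "l2_norm (\<lambda>k. niter a g (Suc (Suc n)) k - niter a g (Suc n) k) \<le> 1/2 * l2_norm ?d"
    using app_half[OF l2_diff(1)[OF niter_l2 niter_l2], of "Suc n" n] by simp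
  then show ?case using Suc by simp
qed

text \<open>The factor 1 - (1/2)^p is the geometric partial sum; keeping it makes the induction on
  \<open>p\<close> close, after which it is bounded by 1.\<close>

lemma niter_diff:
  "l2_norm (\<lambda>k. niter a g (n + p) k - niter a g n k) \<le> (1/2) ^ n * (1 - (1/2) ^ p) * l2_norm g"
proof (induction p)
  case (Suc p)
  let ?x = "\<lambda>k. niter a g (Suc (n + p)) k - niter a g (n + p) k"
  let ?y = "\<lambda>k. niter a g (n + p) k - niter a g n k"
  have "l2_norm (\<lambda>k. ?x k + ?y k) \<le> l2_norm ?x + l2_norm ?y"
    by (intro l2_add l2_diff niter_l2)
  also have "\<dots> \<le> (1/2) ^ Suc (n + p) * l2_norm g + (1/2) ^ n * (1 - (1/2) ^ p) * l2_norm g"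
    by (intro add_mono Suc niter_step)
  also have "\<dots> = (1/2) ^ n * (1 - (1/2) ^ Suc p) * l2_norm g"
    by (simp add: power_add algebra_simps)
  finally show ?case by (simp add: algebra_simps del: niter.simps)
qed simp

lemma niter_diff_le:
  assumes "n \<le> m"
  shows "l2_norm (\<lambda>k. niter a g m k - niter a g n k) \<le> (1/2) ^ n * l2_norm g"
proof -
  have "l2_norm (\<lambda>k. niter a g (n + (m - n)) k - niter a g n k)
      \<le> (1/2) ^ n * (1 - (1/2) ^ (m - n)) * l2_norm g" by (rule niter_diff)
  also have "\<dots> \<le> (1/2) ^ n * 1 * l2_norm g"
    by (intro mult_right_mono mult_left_mono) auto
  finally show ?thesis using assms by simp
qed

lemma niter_tendsto: "(\<lambda>n. niter a g n k) \<longlonglongrightarrow> nsol a g k"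
proof -
  have "summable (\<lambda>n. niter a g (Suc n) k - niter a g n k)"
  proof (rule summable_comparison_test')
    show "summable (\<lambda>n. l2_norm g * (1/2) ^ Suc n)"
      by (intro summable_mult) (simp add: summable_geometric)
    show "cmod (niter a g (Suc n) k - niter a g n k) \<le> l2_norm g * (1/2) ^ Suc n" for n
      using order_trans[OF l2_component_le[OF l2_diff(1)[OF niter_l2 niter_l2]] niter_step]
      by (simp add: mult.commute)
  qed
  then have "(\<lambda>n. \<Sum>i<n. niter a g (Suc i) k - niter a g i k)
      \<longlonglongrightarrow> (\<Sum>i. niter a g (Suc i) k - niter a g i k)"
    by (rule summable_LIMSEQ)
  then have "(\<lambda>n. niter a g n k - niter a g 0 k) \<longlonglongrightarrow> (\<Sum>i. niter a g (Suc i) k - niter a g i k)"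
    unfolding sum_lessThan_telescope[of "\<lambda>n. niter a g n k"] .
  from tendsto_add[OF this tendsto_const[of "niter a g 0 k"]]
  have "convergent (\<lambda>n. niter a g n k)" by (auto simp: convergent_def)
  then show ?thesis unfolding nsol_def by (rule convergent_LIMSEQ_iff[THEN iffD1])
qed

lemma nsol_niter:
  "(\<lambda>k. nsol a g k - niter a g n k) \<in> l2"
  "l2_norm (\<lambda>k. nsol a g k - niter a g n k) \<le> (1/2) ^ n * l2_norm g"
  by (rule l2_Fatou[OF l2_diff(1)[OF niter_l2 niter_l2] niter_diff_le
        tendsto_diff[OF niter_tendsto tendsto_const]], assumption)+

lemma nsol_l2: "nsol a g \<in> l2"
  using l2_add(1)[OF nsol_niter(1)[where n=0] niter_l2[of 0]] by simp

lemma niter_norm: "l2_norm (niter a g n) \<le> 2 * l2_norm g"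
proof -
  have "l2_norm (\<lambda>k. (niter a g n k - niter a g 0 k) + niter a g 0 k)
      \<le> l2_norm (\<lambda>k. niter a g n k - niter a g 0 k) + l2_norm (niter a g 0)"
    by (intro l2_add l2_diff niter_l2)
  then show ?thesis using niter_diff_le[of 0 n] by simp
qed

lemma nsol_norm: "l2_norm (nsol a g) \<le> 2 * l2_norm g"
  by (rule l2_Fatou(2)[where x="niter a g", OF niter_l2 niter_norm niter_tendsto])

text \<open>A pointwise limit cannot simply be moved through the infinite sum in \<open>app\<close>,
  so the defect is estimated instead: comparing with consecutive iterates bounds its norm by (1/2)^n
  times \<open>l2_norm g\<close> for every \<open>n\<close>.\<close>

lemma nsol_eq: "nsol a g k = g k + app a (nsol a g) k"
proof -
  let ?u = "\<lambda>k. nsol a g k - (g k + app a (nsol a g) k)"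
  have u: "?u \<in> l2" by (intro l2_diff l2_add nsol_l2 g app_l2 a)
  have le: "l2_norm ?u \<le> (1/2) ^ n * l2_norm g" for n
  proof -
    let ?x = "\<lambda>k. nsol a g k - niter a g (Suc n) k" and ?y = "\<lambda>k. nsol a g k - niter a g n k"
    have "?u = (\<lambda>k. ?x k - app a ?y k)"
      by (subst app_diff[OF a(1) nsol_l2 niter_l2]) (simp add: algebra_simps)
    then have "l2_norm ?u \<le> l2_norm ?x + l2_norm (app a ?y)"
      using l2_diff(2)[OF nsol_niter(1)[of "Suc n"] app_l2(1)[OF a(1) nsol_niter(1)[of n]]] by simp
    also have "\<dots> \<le> (1/2) ^ Suc n * l2_norm g + 1/2 * ((1/2) ^ n * l2_norm g)"
      by (intro add_mono nsol_niter(2) order_trans[OF app_half[OF nsol_niter(1)]] mult_left_mono) auto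
    finally show ?thesis by (simp add: mult.commute)
  qed
  have "(\<lambda>n. (1/2) ^ n * l2_norm g) \<longlonglongrightarrow> 0 * l2_norm g"
    by (intro tendsto_intros LIMSEQ_power_zero) auto
  then have "l2_norm ?u \<le> 0"
    using le by (intro tendsto_lowerbound[of "\<lambda>n. (1/2) ^ n * l2_norm g" _ sequentially]) auto
  then have "l2_norm ?u = 0" using l2_norm_nonneg[of ?u] by linarith
  then have "?u = (\<lambda>_. 0)" using l2_norm_eq_0[OF u] by simp
  then show ?thesis by (metis eq_iff_diff_eq_0)
qed

text \<open>The difference of two solutions is fixed by a map that at least halves norms.\<close>

lemma nsol_unique:
  assumes x: "x \<in> l2" "\<And>k. x k = g k + app a x k"
  shows "x = nsol a g"
proof -
  let ?d = "\<lambda>k. x k - nsol a g k"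
  have d: "?d \<in> l2" by (intro l2_diff x nsol_l2)
  have "x k - nsol a g k = app a x k - app a (nsol a g) k" for k
    using x(2)[of k] nsol_eq[of k] by (metis add_diff_cancel_left)
  then have "app a ?d = ?d" unfolding app_diff[OF a(1) x(1) nsol_l2] by (intro ext) (rule sym)
  then have "l2_norm ?d \<le> 1/2 * l2_norm ?d" using app_half[OF d] by simp
  then have "l2_norm ?d = 0" using l2_norm_nonneg[of ?d] by linarith
  then have "?d = (\<lambda>_. 0)" using l2_norm_eq_0[OF d] by simp
  then show ?thesis by (simp add: fun_eq_iff)
qed

end

text \<open>Iterates are holomorphic by induction, the bound \<open>2 * l2_norm g\<close> keeping
  \<open>holomorphic_app_aff\<close> applicable at each step; the geometric rate is the same for all
  z in the ball.\<close>

lemma holomorphic_nsol: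
  assumes hs: "hs A" "hs B" and half: "\<And>z. z \<in> ball 0 \<rho> \<Longrightarrow> hs_norm (aff A B z) \<le> 1/2"
    and g: "g \<in> l2"
  shows "(\<lambda>z. nsol (aff A B z) g k) holomorphic_on ball 0 \<rho>"
proof (rule holomorphic_uniform_sequence)
  show "open (ball (0::complex) \<rho>)" by simp
  note h = hs_aff[OF hs] half g
  have "\<forall>k. (\<lambda>z. niter (aff A B z) g n k) holomorphic_on ball 0 \<rho>" for n
  proof (induction n)
    case (Suc n)
    have "(\<lambda>z. app (aff A B z) (niter (aff A B z) g n) k) holomorphic_on ball 0 \<rho>" for k
      by (rule holomorphic_app_aff[OF hs, where C="2 * l2_norm g"])
        (use Suc niter_l2[OF h] niter_norm[OF h] in auto)
    then show ?case by (auto intro!: holomorphic_intros)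
  qed simp
  then show "(\<lambda>z. niter (aff A B z) g n k) holomorphic_on ball 0 \<rho>" for n by blast
  have unif: "uniform_limit (ball 0 \<rho>) (\<lambda>n z. niter (aff A B z) g n k)
      (\<lambda>z. nsol (aff A B z) g k) sequentially"
  proof (rule uniform_limitI)
    fix \<epsilon> :: real assume "\<epsilon> > 0"
    have "(\<lambda>n. (1/2) ^ n * l2_norm g) \<longlonglongrightarrow> 0 * l2_norm g"
      by (intro tendsto_intros LIMSEQ_power_zero) auto
    then have "\<forall>\<^sub>F n in sequentially. (1/2) ^ n * l2_norm g < \<epsilon>"
      using \<open>\<epsilon> > 0\<close> by (intro order_tendstoD(2)[where y="0 * l2_norm g"]) auto
    then show "\<forall>\<^sub>F n in sequentially. \<forall>z\<in>ball 0 \<rho>.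
        dist (niter (aff A B z) g n k) (nsol (aff A B z) g k) < \<epsilon>"
    proof eventually_elim
      case (elim n)
      show ?case
      proof
        fix z :: complex assume "z \<in> ball 0 \<rho>"
        from nsol_niter[OF h(1) h(2)[OF this] h(3), of n]
          l2_component_le[OF nsol_niter(1)[OF h(1) h(2)[OF this] h(3), of n], of k]
        show "dist (niter (aff A B z) g n k) (nsol (aff A B z) g k) < \<epsilon>"
          using elim by (simp add: dist_norm norm_minus_commute)
      qed
    qed
  qed
  show "\<exists>d>0. cball z d \<subseteq> ball 0 \<rho> \<and> uniform_limit (cball z d) (\<lambda>n z. niter (aff A B z) g n k)
      (\<lambda>z. nsol (aff A B z) g k) sequentially" if "z \<in> ball 0 \<rho>" for z
  proof -
    obtain d where d: "d > 0" "cball z d \<subseteq> ball 0 \<rho>"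
      using \<open>z \<in> ball 0 \<rho>\<close> open_contains_cball[of "ball 0 \<rho>"] by (meson open_ball)
    then show ?thesis using uniform_limit_on_subset[OF unif] by blast
  qed
qed

subsection \<open>Reduction to a finite determinant\<close>

definition rmask :: "int set \<Rightarrow> kernel \<Rightarrow> kernel" where
  "rmask P a = (\<lambda>k j. if k \<in> P then 0 else a k j)"

text \<open>The Schur complement of I - L on the coordinates \<open>P\<close>: the inverse of I -
  \<open>rmask P L\<close> eliminates all coordinates outside \<open>P\<close>.\<close>

definition fmat :: "int set \<Rightarrow> kernel \<Rightarrow> int \<Rightarrow> int \<Rightarrow> complex" where
  "fmat P L i j = (if i = j then 1 else 0) - app L (nsol (rmask P L) (e_seq j)) i"

text \<open>The solution \<open>x\<close> of \<open>x = g + y|\<^sub>P + rmask P L x\<close>. It solves \<open>x - L x = g\<close> as soon as \<open>y = L x\<close> on \<open>P\<close>,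
  which is the finite linear system with matrix \<open>fmat P L\<close>.\<close>

definition comb :: "int set \<Rightarrow> kernel \<Rightarrow> seq \<Rightarrow> seq \<Rightarrow> seq" where
  "comb P L g y = (\<lambda>k. nsol (rmask P L) g k + (\<Sum>i\<in>P. y i * nsol (rmask P L) (e_seq i) k))"

lemma app_rmask: "app (rmask P a) x k = (if k \<in> P then 0 else app a x k)"
  by (simp add: app_def rmask_def)

lemma rmask_aff: "rmask P (aff A B z) = aff (rmask P A) (rmask P B) z"
  by (auto simp: rmask_def aff_def fun_eq_iff)

lemma hs_rmask: "hs a \<Longrightarrow> hs (rmask P a)"
  unfolding rmask_def by (rule hs_mask)

context
  fixes L :: kernel and P :: "int set" and g :: seq
  assumes L: "hs L" and P: "finite P" and half: "hs_norm (rmask P L) \<le> 1/2" and g: "g \<in> l2"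
begin

lemmas G_l2 = nsol_l2[OF hs_rmask[OF L] half]
lemmas G_eq = nsol_eq[OF hs_rmask[OF L] half]

lemma comb_l2: "comb P L g y \<in> l2"
  unfolding comb_def by (intro l2_add l2_sum G_l2 g e_seq_l2)

lemma app_comb:
  assumes "hs a"
  shows "app a (comb P L g y) k = app a (nsol (rmask P L) g) k
    + (\<Sum>i\<in>P. y i * app a (nsol (rmask P L) (e_seq i)) k)"
proof -
  have "app a (comb P L g y) = (\<lambda>k. app a (nsol (rmask P L) g) k +
      app a (\<lambda>k. \<Sum>i\<in>P. y i * nsol (rmask P L) (e_seq i) k) k)"
    unfolding comb_def by (intro app_add assms l2_sum G_l2 g e_seq_l2)
  also have "app a (\<lambda>k. \<Sum>i\<in>P. y i * nsol (rmask P L) (e_seq i) k)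
      = (\<lambda>k. \<Sum>i\<in>P. y i * app a (nsol (rmask P L) (e_seq i)) k)"
    by (intro app_sum assms G_l2 e_seq_l2)
  finally show ?thesis by simp
qed

lemma sum_e_seq: "(\<Sum>i\<in>P. y i * e_seq i k) = (if k \<in> P then y k else 0)"
  using P by (auto simp: e_seq_def if_distrib cong: if_cong)

lemma comb_eq:
  "comb P L g y k = g k + (if k \<in> P then y k else 0) + app (rmask P L) (comb P L g y) k"
proof -
  have "comb P L g y k = (g k + app (rmask P L) (nsol (rmask P L) g) k)
      + (\<Sum>i\<in>P. y i * (e_seq i k + app (rmask P L) (nsol (rmask P L) (e_seq i)) k))"
    unfolding comb_def G_eq[OF g, of k, symmetric] G_eq[OF e_seq_l2(1), of _ k, symmetric] ..
  also have "\<dots> = g k + (\<Sum>i\<in>P. y i * e_seq i k) + app (rmask P L) (comb P L g y) k"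
    unfolding app_comb[OF hs_rmask[OF L]] by (simp add: distrib_left sum.distrib)
  finally show ?thesis by (simp only: sum_e_seq)
qed

lemma fmat_sum:
  assumes "i \<in> P"
  shows "(\<Sum>j\<in>P. fmat P L i j * y j) = y i - (\<Sum>j\<in>P. y j * app L (nsol (rmask P L) (e_seq j)) i)"
proof -
  have "(\<Sum>j\<in>P. fmat P L i j * y j)
      = (\<Sum>j\<in>P. (if i = j then y j else 0) - y j * app L (nsol (rmask P L) (e_seq j)) i)"
    by (rule sum.cong) (auto simp: fmat_def algebra_simps)
  then show ?thesis using P assms by (simp add: sum_subtractf)
qed

lemma comb_solves:
  assumes y: "\<And>i. i \<in> P \<Longrightarrow> (\<Sum>j\<in>P. fmat P L i j * y j) = app L (nsol (rmask P L) g) i"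
  shows "comb P L g y k - app L (comb P L g y) k = g k"
proof (cases "k \<in> P")
  case True
  then have "app L (comb P L g y) k = y k"
    using y[OF True] fmat_sum[OF True, of y] app_comb[OF L, of y k] by (simp add: diff_eq_eq)
  then show ?thesis using comb_eq[of y k] True by (simp add: app_rmask)
next
  case False
  then show ?thesis using comb_eq[of y k] by (simp add: app_rmask)
qed

text \<open>With \<open>y\<close> taken to be \<open>app L x\<close>, the equation for
  \<open>x\<close> and the defining equation of \<open>comb\<close> have the same right-hand side,
  and the masked problem has only one solution. Every solution is thus given by finitely many
  numbers, which themselves solve the system with matrix \<open>fmat\<close>.\<close>

lemma solution_comb:
  assumes x: "x \<in> l2" "\<And>k. x k - app L x k = g k"
  shows "x = comb P L g (app L x)"
    and "i \<in> P \<Longrightarrow> (\<Sum>j\<in>P. fmat P L i j * app L x j) = app L (nsol (rmask P L) g) i"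
proof -
  let ?r = "\<lambda>k. g k + (\<Sum>i\<in>P. app L x i * e_seq i k)"
  have r: "?r \<in> l2" by (intro l2_add l2_sum g e_seq_l2)
  have rk: "?r k = g k + (if k \<in> P then app L x k else 0)" for k by (simp only: sum_e_seq)
  have "x k = ?r k + app (rmask P L) x k" for k
    unfolding rk using x(2)[of k, symmetric] by (simp add: app_rmask)
  then have 1: "x = nsol (rmask P L) ?r" by (intro nsol_unique[OF hs_rmask[OF L] half r] x)
  have "comb P L g (app L x) k = ?r k + app (rmask P L) (comb P L g (app L x)) k" for k
    unfolding rk by (rule comb_eq)
  then have "comb P L g (app L x) = nsol (rmask P L) ?r"
    by (intro nsol_unique[OF hs_rmask[OF L] half r] comb_l2)
  with 1 show xc: "x = comb P L g (app L x)" by simp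
  show "(\<Sum>j\<in>P. fmat P L i j * app L x j) = app L (nsol (rmask P L) g) i" if "i \<in> P"
    using app_comb[OF L, of "app L x" i] fmat_sum[OF that, of "app L x"] arg_cong[OF xc, of "\<lambda>x. app L x i"]
    by simp
qed

lemma comb_norm: "l2_norm (comb P L g y) \<le> 2 * l2_norm g + 2 * (\<Sum>i\<in>P. cmod (y i))"
proof -
  have "l2_norm (comb P L g y) \<le> l2_norm (nsol (rmask P L) g)
      + l2_norm (\<lambda>k. \<Sum>i\<in>P. y i * nsol (rmask P L) (e_seq i) k)"
    unfolding comb_def by (intro l2_add l2_sum G_l2 g e_seq_l2)
  also have "\<dots> \<le> 2 * l2_norm g + (\<Sum>i\<in>P. cmod (y i) * l2_norm (nsol (rmask P L) (e_seq i)))"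
    by (intro add_mono nsol_norm[OF hs_rmask[OF L] half g] l2_sum G_l2 e_seq_l2)
  also have "\<dots> \<le> 2 * l2_norm g + (\<Sum>i\<in>P. cmod (y i) * 2)"
    using nsol_norm[OF hs_rmask[OF L] half e_seq_l2(1)] e_seq_l2(2)
    by (intro add_left_mono sum_mono mult_left_mono) auto
  finally show ?thesis by (simp add: sum_distrib_left mult.commute)
qed

end

text \<open>The vectors \<open>b i z\<close> are chosen before \<open>g\<close>, and only the scalar
  coefficients \<open>\<psi>\<close> depend on it; this separation will bound the rank of the Riesz
  projection. The last clause speaks of an arbitrary solution, so it also gives uniqueness wherever
  \<open>\<Delta>\<close> does not vanish.\<close>

theorem analytic_Fredholm:
  assumes hs: "hs A" "hs B"
  shows "\<exists>(P :: int set) \<Delta> b. finite P \<and> \<Delta> holomorphic_on ball 0 \<rho> \<and>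
    (\<forall>i k. (\<lambda>z. b i z k) holomorphic_on ball 0 \<rho>) \<and>
    (\<forall>z\<in>ball 0 \<rho>. \<Delta> z = 0 \<longrightarrow> (\<exists>x\<in>l2. x \<noteq> (\<lambda>_. 0) \<and> app (aff A B z) x = x)) \<and>
    (\<forall>z\<in>ball 0 \<rho>. \<Delta> z \<noteq> 0 \<longrightarrow> (\<exists>C. \<forall>g\<in>l2. \<exists>x\<in>l2. (\<lambda>k. x k - app (aff A B z) x k) = g
        \<and> l2_norm x \<le> C * l2_norm g)) \<and>
    (\<forall>g\<in>l2. \<exists>\<phi> \<psi>. (\<forall>k. (\<lambda>z. \<phi> z k) holomorphic_on ball 0 \<rho>) \<and>
        (\<forall>i\<in>P. \<psi> i holomorphic_on ball 0 \<rho>) \<and>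
        (\<forall>z\<in>ball 0 \<rho>. \<Delta> z \<noteq> 0 \<longrightarrow> (\<forall>x\<in>l2. (\<lambda>k. x k - app (aff A B z) x k) = g \<longrightarrow>
           (\<forall>k. x k = \<phi> z k + (\<Sum>i\<in>P. \<psi> i z * b i z k) / \<Delta> z))))"
proof -
  \<comment> \<open>\<open>P\<close> is chosen for the majorant, hence independently of z; the bound
    1/2 then passes to every z in the ball.\<close>
  obtain P where P: "finite P" "hs_norm (rmask P (maj A B \<rho>)) < 1/2"
    by (rule hs_tail[OF hs_maj[OF hs, of \<rho>], of "1/2"]) (auto simp: rmask_def)
  let ?L = "aff A B"
  let ?G = "\<lambda>z. nsol (rmask P (?L z))"
  have hsm: "hs (rmask P A)" "hs (rmask P B)" using hs by (simp_all add: rmask_def hs_mask)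
  have half: "hs_norm (rmask P (?L z)) \<le> 1/2" if "z \<in> ball 0 \<rho>" for z
  proof -
    have "hs_norm (rmask P (?L z)) \<le> hs_norm (rmask P (maj A B \<rho>))"
    proof (rule hs_mono(2))
      show "hs (rmask P (maj A B \<rho>))" unfolding rmask_def by (rule hs_mask[OF hs_maj[OF hs]])
      show "cmod (rmask P (?L z) k j) \<le> cmod (rmask P (maj A B \<rho>) k j)" for k j
        using aff_le_maj[of z \<rho> A B k j] that by (simp add: rmask_def)
    qed
    then show ?thesis using P(2) by simp
  qed
  note S = hs_aff[OF hs] P(1) half
  have holG: "(\<lambda>z. ?G z g k) holomorphic_on ball 0 \<rho>" if "g \<in> l2" for g k
    unfolding rmask_aff by (rule holomorphic_nsol[OF hsm _ that]) (use half rmask_aff in simp)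
  have holLG: "(\<lambda>z. app (?L z) (?G z g) k) holomorphic_on ball 0 \<rho>" if "g \<in> l2" for g k
    by (rule holomorphic_app_aff[OF hs holG[OF that], where C="2 * l2_norm g"])
      (intro nsol_l2[OF hs_rmask[OF S(1)]] nsol_norm[OF hs_rmask[OF S(1)]] half that, assumption)+
  have holF: "(\<lambda>z. fmat P (?L z) i j) holomorphic_on ball 0 \<rho>" for i j
    unfolding fmat_def by (intro holomorphic_intros holLG e_seq_l2)
  obtain \<Delta> Ad where C: "\<Delta> holomorphic_on ball 0 \<rho>"
    "\<And>i j. i \<in> P \<Longrightarrow> j \<in> P \<Longrightarrow> (\<lambda>z. Ad z i j) holomorphic_on ball 0 \<rho>"
    "\<And>z i k. i \<in> P \<Longrightarrow> k \<in> P \<Longrightarrow>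
      (\<Sum>j\<in>P. Ad z i j * fmat P (?L z) j k) = (if i = k then \<Delta> z else 0)"
    "\<And>z i k. i \<in> P \<Longrightarrow> k \<in> P \<Longrightarrow>
      (\<Sum>j\<in>P. fmat P (?L z) i j * Ad z j k) = (if i = k then \<Delta> z else 0)"
    "\<And>z. \<Delta> z = 0 \<Longrightarrow>
      \<exists>y. (\<exists>i\<in>P. y i \<noteq> 0) \<and> (\<forall>i\<in>P. (\<Sum>j\<in>P. fmat P (?L z) i j * y j) = 0)"
    by (rule holomorphic_Cramer[of P "\<lambda>z. fmat P (?L z)" "ball 0 \<rho>", OF P(1) holF])
      (rule that, assumption+)
  \<comment> \<open>Cramer numerators: adjugate times right-hand side, not yet divided by
    \<open>\<Delta>\<close>, and therefore holomorphic through its zeros.\<close>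
  define \<psi> where "\<psi> g i z = (\<Sum>j\<in>P. Ad z i j * app (?L z) (?G z g) j)" for g i z
  have hol\<psi>: "\<psi> g i holomorphic_on ball 0 \<rho>" if "g \<in> l2" "i \<in> P" for g i
    unfolding \<psi>_def by (intro holomorphic_intros C(2) holLG that)
  show ?thesis
  proof (intro exI[of _ P] exI[of _ \<Delta>] exI[of _ "\<lambda>i z. ?G z (e_seq i)"] conjI ballI allI impI)
    show "finite P" "\<Delta> holomorphic_on ball 0 \<rho>" by fact+
    show "(\<lambda>z. ?G z (e_seq i) k) holomorphic_on ball 0 \<rho>" for i k
      by (rule holG[OF e_seq_l2(1)])
  next
    fix z :: complex assume z: "z \<in> ball 0 \<rho>" and "\<Delta> z = 0"
    obtain y i where y: "i \<in> P" "y i \<noteq> 0" "\<And>i. i \<in> P \<Longrightarrow> (\<Sum>j\<in>P. fmat P (?L z) i j * y j) = 0"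
      using C(5)[OF \<open>\<Delta> z = 0\<close>] by blast
    note S' = S(1) S(2) S(3)[OF z] l2_zero(1)
    have "?G z (\<lambda>_. 0) = (\<lambda>_. 0)"
      by (rule nsol_unique[OF hs_rmask[OF S(1)] S'(3,4), symmetric]) (simp_all add: app_zero)
    then have "app (?L z) (?G z (\<lambda>_. 0)) = (\<lambda>_. 0)" by (simp add: app_zero)
    then have sol: "comb P (?L z) (\<lambda>_. 0) y k - app (?L z) (comb P (?L z) (\<lambda>_. 0) y) k = 0" for k
      using y(3) by (intro comb_solves[OF S']) simp
    have "comb P (?L z) (\<lambda>_. 0) y \<noteq> (\<lambda>_. 0)"
    proof
      assume "comb P (?L z) (\<lambda>_. 0) y = (\<lambda>_. 0)"
      \<comment> \<open>At the coordinate \<open>i\<close> the equation \<open>comb_eq\<close> for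
        the zero vector reduces to y i = 0.\<close>
      then show False using comb_eq[OF S', of y i] y(1,2) by (simp add: app_zero)
    qed
    then show "\<exists>x\<in>l2. x \<noteq> (\<lambda>_. 0) \<and> app (?L z) x = x"
      using sol comb_l2[OF S'] by (intro bexI[of _ "comb P (?L z) (\<lambda>_. 0) y"]) auto
  next
    fix z :: complex assume z: "z \<in> ball 0 \<rho>" and nz: "\<Delta> z \<noteq> 0"
    \<comment> \<open>The right-hand side of the finite system is at most
      \<open>2 * hs_norm (?L z)\<close> times the norm of \<open>g\<close>, the 2 coming from the
      Neumann bound; \<open>K\<close> sums the adjugate entries against this.\<close>
    define K where "K = (\<Sum>i\<in>P. \<Sum>j\<in>P. cmod (Ad z i j) * (2 * hs_norm (?L z))) / cmod (\<Delta> z)"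
    show "\<exists>C. \<forall>g\<in>l2. \<exists>x\<in>l2. (\<lambda>k. x k - app (?L z) x k) = g \<and> l2_norm x \<le> C * l2_norm g"
    proof (intro exI[of _ "2 + 2 * K"] ballI)
      fix g assume g: "g \<in> l2"
      note S' = S(1) S(2) S(3)[OF z] g
      let ?r = "app (?L z) (?G z g)"
      define y where "y i = \<psi> g i z / \<Delta> z" for i
      have "(\<Sum>j\<in>P. fmat P (?L z) i j * y j) = ?r i" if i: "i \<in> P" for i
      proof -
        have "(\<Sum>j\<in>P. fmat P (?L z) i j * y j)
            = (\<Sum>j\<in>P. \<Sum>l\<in>P. fmat P (?L z) i j * Ad z j l * ?r l) / \<Delta> z"
          unfolding y_def \<psi>_def
          by (simp add: sum_divide_distrib sum_distrib_left mult.assoc)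
        also have "(\<Sum>j\<in>P. \<Sum>l\<in>P. fmat P (?L z) i j * Ad z j l * ?r l)
            = (\<Sum>l\<in>P. (\<Sum>j\<in>P. fmat P (?L z) i j * Ad z j l) * ?r l)"
          unfolding sum_distrib_right by (rule sum.swap)
        also have "\<dots> = (\<Sum>l\<in>P. if i = l then \<Delta> z * ?r l else 0)"
          by (rule sum.cong) (auto simp: C(4) i)
        also have "\<dots> = \<Delta> z * ?r i" using P(1) i by simp
        finally show ?thesis using nz by simp
      qed
      then have sol: "comb P (?L z) g y k - app (?L z) (comb P (?L z) g y) k = g k" for k
        by (intro comb_solves[OF S'])
      have r: "cmod (?r j) \<le> 2 * hs_norm (?L z) * l2_norm g" for j
      proof -
        have Gz: "?G z g \<in> l2" by (rule nsol_l2[OF hs_rmask[OF S(1)] S'(3,4)])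
        have "cmod (?r j) \<le> hs_norm (?L z) * l2_norm (?G z g)"
          using l2_component_le[OF app_l2(1)[OF S(1) Gz], of z j] app_l2(2)[OF S(1) Gz, of z] by simp
        also have "\<dots> \<le> hs_norm (?L z) * (2 * l2_norm g)"
          by (intro mult_left_mono nsol_norm[OF hs_rmask[OF S(1)] S'(3,4)]) auto
        finally show ?thesis by (simp add: mult_ac)
      qed
      have "(\<Sum>i\<in>P. cmod (y i)) \<le> K * l2_norm g"
      proof -
        have "cmod (y i) \<le> (\<Sum>j\<in>P. cmod (Ad z i j) * (2 * hs_norm (?L z) * l2_norm g)) / cmod (\<Delta> z)" for i
          unfolding y_def \<psi>_def norm_divide
          by (intro divide_right_mono sum_norm_le) (auto simp: norm_mult intro!: mult_left_mono r)
        then have "(\<Sum>i\<in>P. cmod (y i)) \<le>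
            (\<Sum>i\<in>P. (\<Sum>j\<in>P. cmod (Ad z i j) * (2 * hs_norm (?L z) * l2_norm g)) / cmod (\<Delta> z))"
          by (intro sum_mono)
        also have "\<dots> = K * l2_norm g"
          unfolding K_def by (simp add: sum_distrib_right sum_distrib_left sum_divide_distrib mult_ac)
        finally show ?thesis .
      qed
      then have "l2_norm (comb P (?L z) g y) \<le> (2 + 2 * K) * l2_norm g"
        using comb_norm[OF S', of y] by (simp add: algebra_simps)
      then show "\<exists>x\<in>l2. (\<lambda>k. x k - app (?L z) x k) = g \<and> l2_norm x \<le> (2 + 2 * K) * l2_norm g"
        using sol comb_l2[OF S'] by (intro bexI[of _ "comb P (?L z) g y"]) auto
    qed
  next
    fix g assume g: "g \<in> l2"
    show "\<exists>\<phi> \<psi>. (\<forall>k. (\<lambda>z. \<phi> z k) holomorphic_on ball 0 \<rho>) \<and>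
        (\<forall>i\<in>P. \<psi> i holomorphic_on ball 0 \<rho>) \<and>
        (\<forall>z\<in>ball 0 \<rho>. \<Delta> z \<noteq> 0 \<longrightarrow> (\<forall>x\<in>l2. (\<lambda>k. x k - app (?L z) x k) = g \<longrightarrow>
           (\<forall>k. x k = \<phi> z k + (\<Sum>i\<in>P. \<psi> i z * ?G z (e_seq i) k) / \<Delta> z)))"
    proof (intro exI[of _ "\<lambda>z. ?G z g"] exI[of _ "\<psi> g"] conjI ballI allI impI)
      show "(\<lambda>z. ?G z g k) holomorphic_on ball 0 \<rho>" for k by (rule holG[OF g])
      show "\<psi> g i holomorphic_on ball 0 \<rho>" if "i \<in> P" for i by (rule hol\<psi>[OF g that])
      fix z :: complex and x k
      assume z: "z \<in> ball 0 \<rho>" and nz: "\<Delta> z \<noteq> 0" and x: "x \<in> l2"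
        and eq: "(\<lambda>k. x k - app (?L z) x k) = g"
      note S' = S(1) S(2) S(3)[OF z] g
      have eq': "x k - app (?L z) x k = g k" for k using fun_cong[OF eq, of k] by simp
      note sol = solution_comb[OF S' x eq']
      let ?y = "app (?L z) x" and ?r = "app (?L z) (?G z g)"
      have "\<Delta> z * ?y i = \<psi> g i z" if i: "i \<in> P" for i
      proof -
        \<comment> \<open>Replacing the right-hand side by \<open>fmat\<close> applied to the actual
          values of L_z x puts the adjugate to the left of the matrix, where the two collapse to
          \<open>\<Delta> z\<close>.\<close>
        have "\<psi> g i z = (\<Sum>j\<in>P. Ad z i j * (\<Sum>l\<in>P. fmat P (?L z) j l * ?y l))"
          unfolding \<psi>_def by (rule sum.cong) (auto simp: sol(2))
        also have "\<dots> = (\<Sum>l\<in>P. (\<Sum>j\<in>P. Ad z i j * fmat P (?L z) j l) * ?y l)"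
          unfolding sum_distrib_left sum_distrib_right mult.assoc by (rule sum.swap)
        also have "\<dots> = (\<Sum>l\<in>P. if i = l then \<Delta> z * ?y l else 0)"
          by (rule sum.cong) (auto simp: C(3) i)
        also have "\<dots> = \<Delta> z * ?y i" using P(1) i by simp
        finally show ?thesis by simp
      qed
      then have yi: "?y i = \<psi> g i z / \<Delta> z" if "i \<in> P" for i
        using that nz by (simp add: field_simps)
      have "x k = ?G z g k + (\<Sum>i\<in>P. ?y i * ?G z (e_seq i) k)"
        using fun_cong[OF sol(1), of k] unfolding comb_def .
      also have "(\<Sum>i\<in>P. ?y i * ?G z (e_seq i) k) = (\<Sum>i\<in>P. \<psi> g i z * ?G z (e_seq i) k) / \<Delta> z"
        unfolding sum_divide_distrib by (rule sum.cong) (auto simp: yi)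
      finally show "x k = ?G z g k + (\<Sum>i\<in>P. \<psi> g i z * ?G z (e_seq i) k) / \<Delta> z" .
    qed
  qed
qed

section \<open>The symmetrized potential is Hilbert--Schmidt\<close>

lemma hsI:
  assumes "(\<lambda>(k, j). (cmod (a k j))\<^sup>2) summable_on UNIV \<times> UNIV"
  shows "hs a" and "(hs_norm a)\<^sup>2 = infsum (\<lambda>(k, j). (cmod (a k j))\<^sup>2) (UNIV \<times> UNIV)"
proof -
  have "(\<lambda>j. (cmod (a k j))\<^sup>2) summable_on UNIV" for k
    using summable_on_SigmaD1[OF assms] by simp
  then have rows: "a k \<in> l2" for k by (simp add: l2_def)
  have sq: "(cmod (row_norm a k))\<^sup>2 = (\<Sum>\<^sub>\<infinity>j. (cmod (a k j))\<^sup>2)" for k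
    by (simp add: row_norm_def l2_norm_power2)
  have "(\<lambda>k. \<Sum>\<^sub>\<infinity>j. (cmod (a k j))\<^sup>2) summable_on UNIV"
    using summable_on_Sigma_banach[OF assms] by simp
  then have "row_norm a \<in> l2" unfolding l2_def sq[symmetric] by simp
  then show "hs a" using rows by (simp add: hs_def)
  show "(hs_norm a)\<^sup>2 = infsum (\<lambda>(k, j). (cmod (a k j))\<^sup>2) (UNIV \<times> UNIV)"
    unfolding hs_norm_def l2_norm_power2 sq using infsum_Sigma'_banach[OF assms] by simp
qed

text \<open>By translation and reflection every row and every column of c(k - j) sums to the total
  of \<open>c\<close>; summing against \<open>a\<close> in the other index gives the product. Both
  versions occur because the kernel estimate has one term weighted in \<open>k\<close> and one in
  \<open>j\<close>.\<close>

lemma conv_product_summable: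
  fixes c a :: "int \<Rightarrow> real"
  assumes c: "c summable_on UNIV" "\<And>n. 0 \<le> c n" and a: "a summable_on UNIV" "\<And>n. 0 \<le> a n"
  shows "(\<lambda>(k, j). c (k - j) * a k) summable_on UNIV \<times> UNIV"
    and "infsum (\<lambda>(k, j). c (k - j) * a k) (UNIV \<times> UNIV) = infsum c UNIV * infsum a UNIV"
    and "(\<lambda>(k, j). c (k - j) * a j) summable_on UNIV \<times> UNIV"
    and "infsum (\<lambda>(k, j). c (k - j) * a j) (UNIV \<times> UNIV) = infsum c UNIV * infsum a UNIV"
proof -
  have main: "((\<lambda>p. case p of (k, j) \<Rightarrow> c' k j * a k) has_sum (infsum c UNIV * infsum a UNIV)) (UNIV \<times> UNIV)"
    if c': "\<And>k. (c' k has_sum infsum c UNIV) UNIV" "\<And>k j. 0 \<le> c' k j" for c'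
  proof -
    have 1: "((\<lambda>j. c' k j * a k) has_sum (infsum c UNIV * a k)) UNIV" for k
      by (rule has_sum_cmult_left[OF c'(1)])
    have s: "(\<lambda>p. case p of (k, j) \<Rightarrow> c' k j * a k) summable_on (UNIV \<times> UNIV)"
      by (rule summable_on_SigmaI[where g="\<lambda>k. infsum c UNIV * a k"])
        (use 1 a c' in \<open>auto intro!: summable_on_cmult_right\<close>)
    have "infsum (\<lambda>p. case p of (k, j) \<Rightarrow> c' k j * a k) (UNIV \<times> UNIV)
        = (\<Sum>\<^sub>\<infinity>k. \<Sum>\<^sub>\<infinity>j. c' k j * a k)"
      by (rule infsum_Sigma'_banach[OF s, symmetric])
    also have "\<dots> = infsum c UNIV * infsum a UNIV"
      using infsumI[OF 1] by (simp add: infsum_cmult_right')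
    finally show ?thesis using s by (simp add: has_sum_iff)
  qed
  have h1: "((\<lambda>j. c (k - j)) has_sum infsum c UNIV) UNIV" for k
    by (rule has_sum_reindex_bij_witness[of UNIV "\<lambda>j. k - j" "\<lambda>j. k - j" UNIV c, THEN iffD2])
      (use c in auto)
  have h2: "((\<lambda>k. c (k - j)) has_sum infsum c UNIV) UNIV" for j
    by (rule has_sum_reindex_bij_witness[of UNIV "\<lambda>k. k + j" "\<lambda>k. k - j" UNIV c, THEN iffD2])
      (use c in auto)
  note m1 = main[OF h1 c(2)]
  from m1 show "(\<lambda>(k, j). c (k - j) * a k) summable_on UNIV \<times> UNIV"
    and "infsum (\<lambda>(k, j). c (k - j) * a k) (UNIV \<times> UNIV) = infsum c UNIV * infsum a UNIV"
    by (auto simp: has_sum_iff)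
  note m2 = main[of "\<lambda>j k. c (k - j)", OF h2 c(2)]
  have "((\<lambda>p. case p of (k, j) \<Rightarrow> c (k - j) * a j) has_sum (infsum c UNIV * infsum a UNIV)) (UNIV \<times> UNIV)"
    by (rule has_sum_reindex_bij_witness[of _ prod.swap prod.swap, THEN iffD1, OF _ _ _ _ _ _ m2]) auto
  then show "(\<lambda>(k, j). c (k - j) * a j) summable_on UNIV \<times> UNIV"
    and "infsum (\<lambda>(k, j). c (k - j) * a j) (UNIV \<times> UNIV) = infsum c UNIV * infsum a UNIV"
    by (auto simp: has_sum_iff)
qed

section \<open>Growth of the weights and summability of their inverses\<close>

definition wt :: "nat \<Rightarrow> bool \<Rightarrow> real \<Rightarrow> int \<Rightarrow> real" where
  "wt m pm \<mu> k = (real_of_int (freq pm k) * pi) ^ (2 * m) + \<mu>"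

lemma even_power_nonneg: "0 \<le> (x::real) ^ (2 * m)"
  by (simp add: power_mult)

lemma wt_ge:
  assumes "\<mu> \<ge> 1"
  shows "wt m pm \<mu> k \<ge> 1" and "wt m pm \<mu> k \<ge> \<mu>"
    and "wt m pm \<mu> k \<ge> \<bar>real_of_int (freq pm k)\<bar> ^ (2 * m)"
proof -
  have "\<bar>real_of_int (freq pm k)\<bar> ^ (2 * m) \<le> \<bar>real_of_int (freq pm k) * pi\<bar> ^ (2 * m)"
    using pi_gt3 by (intro power_mono) (auto simp: abs_mult intro!: mult_le_cancel_left1[THEN iffD2])
  also have "\<dots> = (real_of_int (freq pm k) * pi) ^ (2 * m)" by (simp add: power_mult)
  finally show "wt m pm \<mu> k \<ge> \<bar>real_of_int (freq pm k)\<bar> ^ (2 * m)"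
    using assms by (simp add: wt_def)
  show "wt m pm \<mu> k \<ge> 1" "wt m pm \<mu> k \<ge> \<mu>"
    using assms even_power_nonneg[of "real_of_int (freq pm k) * pi" m] unfolding wt_def by linarith+
qed

text \<open>The average of the bounds w \<ge> k^2 and w \<ge> 1. The first rests on |k| \<le> |freq
  pm k|, which holds for both signs, and on 2m \<ge> 2.\<close>

lemma wt_ge_square:
  assumes "\<mu> \<ge> 1" "m \<ge> 1" shows "wt m pm \<mu> k \<ge> (real_of_int k)\<^sup>2 / 2 + 1/2"
proof -
  have kf: "\<bar>k\<bar> \<le> \<bar>freq pm k\<bar>" by (auto simp: freq_def)
  show ?thesis
  proof (cases "freq pm k = 0")
    case True
    then have "k = 0" using kf by simp
    then show ?thesis using wt_ge(1)[OF assms(1), of m pm k] by simp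
  next
    case False
    then have f1: "1 \<le> \<bar>real_of_int (freq pm k)\<bar>" by linarith
    have "(real_of_int k)\<^sup>2 \<le> \<bar>real_of_int (freq pm k)\<bar> ^ 2"
      using kf by (metis abs_ge_zero of_int_abs of_int_le_iff power2_abs power_mono of_int_0_le_iff)
    also have "\<dots> \<le> \<bar>real_of_int (freq pm k)\<bar> ^ (2 * m)"
      using f1 assms(2) by (intro power_increasing) auto
    finally have "(real_of_int k)\<^sup>2 \<le> wt m pm \<mu> k" using wt_ge(3)[OF assms(1), of pm k m] by linarith
    then show ?thesis using wt_ge(1)[OF assms(1), of m pm k] by simp
  qed
qed

lemma summable_on_int_inverse_square: "(\<lambda>k::int. 1 / ((real_of_int k)\<^sup>2 + 1)) summable_on UNIV"
proof -
  let ?f = "\<lambda>k::int. 1 / ((real_of_int k)\<^sup>2 + 1)"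
  have s: "summable (\<lambda>n. 1 / ((real n)\<^sup>2 + 1))"
  proof (rule summable_comparison_test')
    show "summable (\<lambda>n. inverse ((real n)\<^sup>2))" by (rule inverse_power_summable) simp
    show "norm (1 / ((real n)\<^sup>2 + 1)) \<le> inverse ((real n)\<^sup>2)" if "n \<ge> 1" for n
      unfolding inverse_eq_divide using that by (simp add: frac_le)
  qed
  have n: "(\<lambda>n::nat. 1 / ((real n)\<^sup>2 + 1)) summable_on UNIV"
    by (rule norm_summable_imp_summable_on) (use s in simp)
  have 1: "?f summable_on (range int)"
    by (subst summable_on_reindex) (use n in \<open>auto simp: o_def\<close>)
  have 2: "?f summable_on (range (\<lambda>n. - int n))"
    by (subst summable_on_reindex) (use n in \<open>auto simp: o_def inj_def\<close>)
  have "range int \<union> range (\<lambda>n. - int n) = UNIV"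
  proof -
    have "k \<in> range int \<union> range (\<lambda>n. - int n)" for k :: int
      by (cases k rule: int_cases2) auto
    then show ?thesis by blast
  qed
  then show ?thesis using summable_on_union[OF 1 2] by simp
qed

lemma inverse_wt_bound:
  assumes "\<mu> \<ge> 1" "m \<ge> 1"
  shows "0 \<le> 1 / wt m pm \<mu> k" "1 / wt m pm \<mu> k \<le> 2 * (1 / ((real_of_int k)\<^sup>2 + 1))"
    "1 / wt m pm \<mu> k \<le> 1 / \<mu>"
proof -
  have pos: "wt m pm \<mu> k > 0" using wt_ge(1)[OF assms(1), of m pm k] by linarith
  show "0 \<le> 1 / wt m pm \<mu> k" using pos by simp
  have "1 / wt m pm \<mu> k \<le> 1 / (((real_of_int k)\<^sup>2 + 1) / 2)"
    using wt_ge_square[OF assms, of k pm]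
    by (intro divide_left_mono mult_pos_pos pos) (auto simp: field_simps add_pos_nonneg)
  then show "1 / wt m pm \<mu> k \<le> 2 * (1 / ((real_of_int k)\<^sup>2 + 1))" by simp
  show "1 / wt m pm \<mu> k \<le> 1 / \<mu>"
    using wt_ge(2)[OF assms(1), of m pm k] assms pos by (intro divide_left_mono) auto
qed

lemma inverse_wt_summable:
  assumes "\<mu> \<ge> 1" "m \<ge> 1"
  shows "(\<lambda>k. 1 / wt m pm \<mu> k) summable_on UNIV"
  by (rule summable_on_comparison_test[OF summable_on_cmult_right[OF summable_on_int_inverse_square, of 2]])
    (use inverse_wt_bound[OF assms] in auto)

text \<open>Dominated convergence by hand: a finite set \<open>F\<close>, fixed before
  \<open>\<mu>\<close>, leaves a tail small for all admissible \<open>\<mu>\<close>, and on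
  \<open>F\<close> every term is at most 1/\<mu>.\<close>

lemma inverse_wt_small:
  assumes "m \<ge> 1" "\<epsilon> > 0"
  shows "\<exists>\<mu>\<ge>1. infsum (\<lambda>k. 1 / wt m pm \<mu> k) UNIV < \<epsilon>"
proof -
  let ?h = "\<lambda>k::int. 2 * (1 / ((real_of_int k)\<^sup>2 + 1))"
  have sh: "?h summable_on UNIV" by (intro summable_on_cmult_right summable_on_int_inverse_square)
  obtain F where F: "finite F" "dist (sum ?h F) (infsum ?h UNIV) \<le> \<epsilon>/3"
    using infsum_finite_approximation[OF sh, of "\<epsilon>/3"] assms(2) by auto
  have shF: "?h summable_on - F" by (rule summable_on_subset[OF sh]) auto
  have "infsum ?h UNIV = sum ?h F + infsum ?h (- F)"
    using infsum_Un_disjoint[of ?h F "- F"] F(1) shF by (simp add: summable_on_finite)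
  then have tail: "infsum ?h (- F) \<le> \<epsilon>/3" using F(2) unfolding dist_real_def by linarith
  \<comment> \<open>Chosen so that card F / \<mu> is at most \<epsilon>/3; the summand 1 keeps \<mu>
    \<ge> 1 also for empty \<open>F\<close>.\<close>
  define \<mu> where "\<mu> = 1 + 3 * real (card F) / \<epsilon>"
  have mu: "\<mu> \<ge> 1" using assms by (simp add: \<mu>_def)
  let ?w = "\<lambda>k. 1 / wt m pm \<mu> k"
  have sw: "?w summable_on UNIV" by (rule inverse_wt_summable[OF mu assms(1)])
  have swF: "?w summable_on - F" by (rule summable_on_subset[OF sw]) auto
  have "infsum ?w UNIV = sum ?w F + infsum ?w (- F)"
    using infsum_Un_disjoint[of ?w F "- F"] F(1) swF by (simp add: summable_on_finite)
  also have "sum ?w F \<le> real (card F) * (1 / \<mu>)"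
    using sum_bounded_above[of F ?w "1/\<mu>"] inverse_wt_bound(3)[OF mu assms(1)] by simp
  also have "infsum ?w (- F) \<le> infsum ?h (- F)"
    by (rule infsum_mono[OF swF shF]) (rule inverse_wt_bound(2)[OF mu assms(1)])
  also have "real (card F) * (1 / \<mu>) \<le> \<epsilon> / 3"
    using assms(2) mu by (simp add: \<mu>_def field_simps)
  finally have "infsum ?w UNIV \<le> \<epsilon> / 3 + \<epsilon> / 3" using tail by linarith
  then have "infsum ?w UNIV < \<epsilon>" using assms(2) by linarith
  then show ?thesis using mu by blast
qed

section \<open>Hilbert-Schmidt estimate for the symmetrized potential\<close>

definition Kker :: "nat \<Rightarrow> seq \<Rightarrow> bool \<Rightarrow> real \<Rightarrow> kernel" where
  "Kker m V pm \<mu> k j = V (k - j) / complex_of_real (sqrt (wt m pm \<mu> k) * sqrt (wt m pm \<mu> j))"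

text \<open>2(k - j) is the difference of the two frequencies for either sign, so its bracket is at
  most three times the largest of 1 and their absolute values. Each of these candidates for
  \<open>t\<close> has t^(2m) below one of the weights; rounding 3 up to 4 gives 4^(2m) =
  16^m.\<close>

lemma jbr_difference:
  assumes "\<mu> \<ge> 1"
  shows "jbr (2 * (k - j)) ^ (2 * m) \<le> 16 ^ m * (wt m pm \<mu> k + wt m pm \<mu> j)"
proof -
  let ?f = "\<lambda>k. \<bar>real_of_int (freq pm k)\<bar>"
  have "jbr (2 * (k - j)) = 1 + \<bar>real_of_int (freq pm k) - real_of_int (freq pm j)\<bar>"
    by (simp add: jbr_def freq_def algebra_simps)
  then have 1: "jbr (2 * (k - j)) \<le> 1 + ?f k + ?f j" by linarith
  have b: "1 \<le> wt m pm \<mu> k" "1 \<le> wt m pm \<mu> j" "?f k ^ (2 * m) \<le> wt m pm \<mu> k"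
    "?f j ^ (2 * m) \<le> wt m pm \<mu> j" using wt_ge[OF assms] by auto
  obtain t where t: "jbr (2 * (k - j)) \<le> 4 * t" "t ^ (2 * m) \<le> wt m pm \<mu> k + wt m pm \<mu> j"
  proof -
    consider "?f k \<le> 1" "?f j \<le> 1" | "1 \<le> ?f k" "?f j \<le> ?f k" | "1 \<le> ?f j" "?f k \<le> ?f j"
      by linarith
    then show thesis
    proof cases
      case 1 then show thesis using that[of 1] \<open>jbr _ \<le> _\<close> b by auto
    next
      case 2 then show thesis using that[of "?f k"] \<open>jbr _ \<le> _\<close> b by linarith
    next
      case 3 then show thesis using that[of "?f j"] \<open>jbr _ \<le> _\<close> b by linarith
    qed
  qed
  have "jbr (2 * (k - j)) ^ (2 * m) \<le> (4 * t) ^ (2 * m)"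
    by (rule power_mono[OF t(1)]) (simp add: jbr_def)
  also have "\<dots> = 16 ^ m * t ^ (2 * m)" by (simp add: power_mult_distrib power_mult)
  also have "\<dots> \<le> 16 ^ m * (wt m pm \<mu> k + wt m pm \<mu> j)" using t(2) by simp
  finally show ?thesis .
qed

text \<open>Since (a + b)/(a b) = 1/a + 1/b, the previous estimate trades the product of weights for
  the Sobolev weight of \<open>V\<close> at k - j and a sum of single inverse weights, leaving two
  convolution-type terms.\<close>

lemma Kker_bound:
  assumes "\<mu> \<ge> 1"
  shows "(cmod (Kker m V pm \<mu> k j))\<^sup>2 \<le> 16 ^ m *
    (jbr (2 * (k - j)) powr (2 * (- real m)) * (cmod (V (k - j)))\<^sup>2) *
    (1 / wt m pm \<mu> k + 1 / wt m pm \<mu> j)"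
proof -
  let ?a = "wt m pm \<mu> k" and ?b = "wt m pm \<mu> j" and ?v = "(cmod (V (k - j)))\<^sup>2"
  let ?J = "jbr (2 * (k - j)) ^ (2 * m)"
  have ab: "?a > 0" "?b > 0" using wt_ge(1)[OF assms, of m pm k] wt_ge(1)[OF assms, of m pm j] by simp_all
  have j0: "jbr (2 * (k - j)) > 0" by (simp add: jbr_def)
  then have J: "?J > 0" by simp
  have powr: "jbr (2 * (k - j)) powr (2 * (- real m)) = 1 / ?J"
    using powr_realpow[OF j0, of "2 * m"] powr_minus_divide[of "jbr (2 * (k - j))" "2 * real m"] by simp
  have "(cmod (Kker m V pm \<mu> k j))\<^sup>2 = ?v / (?a * ?b)"
    using ab by (simp add: Kker_def norm_divide norm_mult power_divide power_mult_distrib)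
  also have "\<dots> = ?v * (?J / (?J * (?a * ?b)))"
    using J unfolding mult_divide_mult_cancel_left_if nonzero_divide_mult_cancel_left[OF less_imp_neq[OF J, symmetric]] by simp
  also have "\<dots> \<le> ?v * (16 ^ m * (?a + ?b) / (?J * (?a * ?b)))"
    using jbr_difference[OF assms, of k j m pm] J ab
    by (intro mult_left_mono divide_right_mono) auto
  also have "\<dots> = 16 ^ m * (1 / ?J * ?v) * (1 / ?a + 1 / ?b)"
    using J ab by (simp add: field_simps)
  finally show ?thesis unfolding powr .
qed

text \<open>The total of \<open>c\<close> is the squared H_+^(-m) norm of \<open>V\<close>,
  whichever sign \<open>pm\<close> selects, and it does not involve \<open>\<mu>\<close>; the factor
  2 counts the two convolution terms.\<close>

lemma Kker_hs:
  assumes "\<mu> \<ge> 1" "m \<ge> 1" and V: "V \<in> Hs True (- real m)"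
  defines "c \<equiv> \<lambda>n. jbr (2 * n) powr (2 * (- real m)) * (cmod (V n))\<^sup>2"
  shows "hs (Kker m V pm \<mu>)"
    and "(hs_norm (Kker m V pm \<mu>))\<^sup>2 \<le> 2 * 16 ^ m * infsum c UNIV * infsum (\<lambda>k. 1 / wt m pm \<mu> k) UNIV"
proof -
  let ?w = "\<lambda>k. 1 / wt m pm \<mu> k"
  let ?K = "Kker m V pm \<mu>"
  have c: "c summable_on UNIV" "\<And>n. 0 \<le> c n"
    using V by (auto simp: c_def Hs_def freq_def)
  note cp = conv_product_summable[OF c inverse_wt_summable[OF assms(1,2), of pm] inverse_wt_bound(1)[OF assms(1,2), of pm]]
  let ?g = "\<lambda>p. (case p of (k, j) \<Rightarrow> c (k - j) * ?w k) + (case p of (k, j) \<Rightarrow> c (k - j) * ?w j)"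
  have sg: "?g summable_on UNIV \<times> UNIV" by (intro summable_on_add cp)
  have ig: "infsum ?g (UNIV \<times> UNIV) = 2 * infsum c UNIV * infsum ?w UNIV"
    unfolding infsum_add[OF cp(1) cp(3)] cp(2,4) by simp
  have le: "(case p of (k, j) \<Rightarrow> (cmod (?K k j))\<^sup>2) \<le> 16 ^ m * ?g p" for p
    using Kker_bound[OF assms(1), of m V pm "fst p" "snd p"]
    by (cases p) (simp add: c_def algebra_simps)
  have s: "(\<lambda>(k, j). (cmod (?K k j))\<^sup>2) summable_on UNIV \<times> UNIV"
    by (rule summable_on_comparison_test[OF summable_on_cmult_right[OF sg, of "16 ^ m"]])
      (use le in auto)
  show "hs ?K" by (rule hsI[OF s])
  have "(hs_norm ?K)\<^sup>2 \<le> infsum (\<lambda>p. 16 ^ m * ?g p) (UNIV \<times> UNIV)"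
    unfolding hsI(2)[OF s] by (rule infsum_mono[OF s summable_on_cmult_right[OF sg]]) (rule le)
  also have "\<dots> = 2 * 16 ^ m * infsum c UNIV * infsum ?w UNIV"
    unfolding infsum_cmult_right' ig by simp
  finally show "(hs_norm ?K)\<^sup>2 \<le> 2 * 16 ^ m * infsum c UNIV * infsum ?w UNIV" .
qed

lemma Kker_small:
  assumes "m \<ge> 1" "V \<in> Hs True (- real m)" "\<eta> > 0"
  shows "\<exists>\<mu>\<ge>1. hs_norm (Kker m V pm \<mu>) \<le> \<eta>"
proof -
  let ?c = "\<lambda>n. jbr (2 * n) powr (2 * (- real m)) * (cmod (V n))\<^sup>2"
  \<comment> \<open>The tolerance below divides by \<open>C + 1\<close>, as \<open>C\<close> is zero
    for vanishing \<open>V\<close>.\<close>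
  define C where "C = 2 * 16 ^ m * infsum ?c UNIV"
  have C: "C \<ge> 0" unfolding C_def by (intro mult_nonneg_nonneg infsum_nonneg) auto
  have "\<eta>\<^sup>2 / (C + 1) > 0" using C assms(3) by simp
  from inverse_wt_small[OF assms(1) this, of pm] obtain \<mu>
    where mu: "\<mu> \<ge> 1" "infsum (\<lambda>k. 1 / wt m pm \<mu> k) UNIV < \<eta>\<^sup>2 / (C + 1)"
    by blast
  have "(hs_norm (Kker m V pm \<mu>))\<^sup>2 \<le> C * infsum (\<lambda>k. 1 / wt m pm \<mu> k) UNIV"
    unfolding C_def by (rule Kker_hs(2)[OF mu(1) assms(1,2)])
  also have "\<dots> \<le> C * (\<eta>\<^sup>2 / (C + 1))" using mu(2) C by (intro mult_left_mono) auto
  also have "\<dots> \<le> \<eta>\<^sup>2" using C by (simp add: field_simps)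
  finally have "hs_norm (Kker m V pm \<mu>) \<le> \<eta>" 
    by (rule power2_le_imp_le) (use assms(3) in simp)
  then show ?thesis using mu(1) by blast
qed

section \<open>The operator in symmetrized coordinates\<close>

text \<open>The assumption \<open>half\<close> makes I + K invertible by a Neumann series. This
  provides the regular point \<open>- \<mu>\<close>, the nonvanishing of the determinant there, and
  the density of the image of the domain under w^(1/2).\<close>

locale symmetrized =
  fixes m :: nat and V :: seq and pm :: bool and \<mu> :: real
  assumes m: "m \<ge> 1" and V: "V \<in> Hs True (- real m)" and mu: "\<mu> \<ge> 1"
    and half: "hs_norm (Kker m V pm \<mu>) \<le> 1/2"
begin

abbreviation "S \<equiv> S_op m V pm"
abbreviation "D \<equiv> S_dom m V pm"
abbreviation "w \<equiv> wt m pm \<mu>"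
abbreviation "K \<equiv> Kker m V pm \<mu>"

text \<open>\<open>dn\<close> lowers and \<open>up\<close> raises the Sobolev order by m: between
  them they identify the form domain H^m with \<open>l2\<close>.\<close>

definition dn :: "seq \<Rightarrow> seq" where "dn u = (\<lambda>k. complex_of_real (sqrt (w k)) * u k)"
definition up :: "seq \<Rightarrow> seq" where "up x = (\<lambda>k. x k / complex_of_real (sqrt (w k)))"
definition Dg :: kernel where "Dg = (\<lambda>k j. if k = j then 1 / complex_of_real (w k) else 0)"
text \<open>The part of L_z = (z + \<mu>) w^(-1) - K that is free of z, so that
  \<open>aff A0 Dg z\<close> is exactly L_z.\<close>

definition A0 :: kernel where "A0 = (\<lambda>k j. complex_of_real \<mu> * Dg k j + (- 1) * K k j)"

abbreviation "L \<equiv> aff A0 Dg"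

lemma w_ge: "w k \<ge> 1" and w_pos: "w k > 0" and sqrt_w: "sqrt (w k) \<ge> 1"
  and w_sq: "complex_of_real (sqrt (w k)) * complex_of_real (sqrt (w k)) = complex_of_real (w k)"
proof -
  show 1: "w k \<ge> 1" by (rule wt_ge[OF mu])
  then show "w k > 0" "sqrt (w k) \<ge> 1" by auto
  show "complex_of_real (sqrt (w k)) * complex_of_real (sqrt (w k)) = complex_of_real (w k)"
    unfolding of_real_mult[symmetric] using 1 by simp
qed

lemma sqrt_w_nz: "complex_of_real (sqrt (w k)) \<noteq> 0"
  using sqrt_w[of k] by (metis of_real_eq_0_iff not_one_le_zero)

lemma up_dn: "up (dn u) = u" and dn_up: "dn (up x) = x"
  using sqrt_w_nz by (auto simp: up_def dn_def)

lemma up_l2: "x \<in> l2 \<Longrightarrow> up x \<in> l2" "x \<in> l2 \<Longrightarrow> l2_norm (up x) \<le> l2_norm x"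
proof -
  have "cmod (up x k) \<le> cmod (x k)" for k
  proof -
    have "cmod (up x k) = cmod (x k) / sqrt (w k)"
      using w_pos[of k] by (simp add: up_def norm_divide)
    also have "\<dots> \<le> cmod (x k) / 1" using sqrt_w[of k] by (intro divide_left_mono) auto
    finally show ?thesis by simp
  qed
  then show "x \<in> l2 \<Longrightarrow> up x \<in> l2" "x \<in> l2 \<Longrightarrow> l2_norm (up x) \<le> l2_norm x"
    using l2_mono[of x "up x"] by auto
qed

text \<open>The weights w and (1 + |n|)^(2m) are comparable in both directions, which is what makes
  H^m the natural domain of w^(1/2).\<close>

lemma dn_l2_iff: "dn u \<in> l2 \<longleftrightarrow> u \<in> Hs pm (real m)"
proof -
  let ?j = "\<lambda>k. jbr (freq pm k) ^ (2 * m)"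
  have j: "jbr (freq pm k) powr (2 * real m) = ?j k" for k
    using powr_realpow[of "jbr (freq pm k)" "2 * m"] by (simp add: jbr_def)
  have d: "(cmod (dn u k))\<^sup>2 = w k * (cmod (u k))\<^sup>2" for k
    using w_pos[of k] by (simp add: dn_def norm_mult power_mult_distrib)
  have wj: "w k \<le> (pi ^ (2 * m) + \<mu>) * ?j k" for k
  proof -
    have "(real_of_int (freq pm k) * pi) ^ (2 * m) = \<bar>real_of_int (freq pm k)\<bar> ^ (2 * m) * pi ^ (2 * m)"
      by (simp add: power_mult power_mult_distrib)
    also have "\<dots> \<le> ?j k * pi ^ (2 * m)"
      by (intro mult_right_mono power_mono) (auto simp: jbr_def)
    finally have 1: "(real_of_int (freq pm k) * pi) ^ (2 * m) \<le> ?j k * pi ^ (2 * m)" .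
    have "1 \<le> ?j k" by (rule one_le_power) (simp add: jbr_def)
    then have "\<mu> * 1 \<le> \<mu> * ?j k" using mu by (intro mult_left_mono) auto
    with 1 show ?thesis unfolding wt_def distrib_right by (simp only: mult.commute[of "pi ^ (2 * m)"])
  qed
  have jw: "?j k \<le> 4 ^ m * (2 * w k)" for k
  proof -
    let ?f = "\<bar>real_of_int (freq pm k)\<bar>"
    have le: "jbr (freq pm k) \<le> 2 * max 1 ?f" by (simp add: jbr_def)
    have "?j k \<le> (2 * max 1 ?f) ^ (2 * m)"
      by (rule power_mono[OF le]) (simp add: jbr_def)
    also have "\<dots> = 4 ^ m * max 1 ?f ^ (2 * m)" by (simp add: power_mult_distrib power_mult)
    also have "max 1 ?f ^ (2 * m) \<le> 2 * w k"
      using wt_ge(1)[OF mu, of m pm k] wt_ge(3)[OF mu, of pm k m] by (simp add: max_def)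
    finally show ?thesis by simp
  qed
  show ?thesis
  proof
    assume "dn u \<in> l2"
    then have s: "(\<lambda>k. w k * (cmod (u k))\<^sup>2) summable_on UNIV" by (simp add: l2_def d)
    have "(\<lambda>k. ?j k * (cmod (u k))\<^sup>2) summable_on UNIV"
    proof (rule summable_on_comparison_test[OF summable_on_cmult_right[OF s, of "4 ^ m * 2"]])
      show "?j k * (cmod (u k))\<^sup>2 \<le> 4 ^ m * 2 * (w k * (cmod (u k))\<^sup>2)" for k
        using mult_right_mono[OF jw[of k], of "(cmod (u k))\<^sup>2"] by (simp add: mult.assoc)
    qed (simp add: jbr_def)
    then show "u \<in> Hs pm (real m)" by (simp add: Hs_def j)
  next
    assume "u \<in> Hs pm (real m)"
    then have s: "(\<lambda>k. ?j k * (cmod (u k))\<^sup>2) summable_on UNIV" by (simp add: Hs_def j)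
    have "(\<lambda>k. w k * (cmod (u k))\<^sup>2) summable_on UNIV"
    proof (rule summable_on_comparison_test[OF summable_on_cmult_right[OF s, of "pi ^ (2 * m) + \<mu>"]])
      show "w k * (cmod (u k))\<^sup>2 \<le> (pi ^ (2 * m) + \<mu>) * (?j k * (cmod (u k))\<^sup>2)" for k
        using mult_right_mono[OF wj[of k], of "(cmod (u k))\<^sup>2"] by (simp add: mult.assoc)
    qed (use w_pos in \<open>simp add: less_imp_le\<close>)
    then show "dn u \<in> l2" by (simp add: l2_def d)
  qed
qed

lemma Hs_l2: "u \<in> Hs pm (real m) \<Longrightarrow> u \<in> l2"
  using up_l2(1)[of "dn u"] by (simp add: dn_l2_iff up_dn)

lemma D_iff: "u \<in> D \<longleftrightarrow> dn u \<in> l2 \<and> S u \<in> l2"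
  by (simp add: S_dom_def dn_l2_iff)

lemma D_l2: "u \<in> D \<Longrightarrow> u \<in> l2"
  by (simp add: S_dom_def Hs_l2)

lemma hs_K: "hs K"
  by (rule Kker_hs(1)[OF mu m V])

lemma hs_Dg: "hs Dg"
proof -
  have row: "Dg k = (\<lambda>j. 1 / complex_of_real (w k) * e_seq k j)" for k
    by (auto simp: Dg_def e_seq_def)
  have rl: "Dg k \<in> l2" "l2_norm (Dg k) = 1 / w k" for k
    unfolding row l2_scale(2)[OF e_seq_l2(1)] e_seq_l2(2)
    using w_pos[of k] by (simp_all only: l2_scale(1)[OF e_seq_l2(1)]) (simp add: norm_divide)
  have "(\<lambda>k. (1 / w k)\<^sup>2) summable_on UNIV"
  proof (rule summable_on_comparison_test[OF inverse_wt_summable[OF mu m, of pm]])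
    show "(1 / w k)\<^sup>2 \<le> 1 / w k" for k
      using w_ge[of k] mult_left_le_one_le[of "1 / w k" "1 / w k"] by (simp add: power2_eq_square)
  qed simp
  moreover have "(cmod (row_norm Dg k))\<^sup>2 = (1 / w k)\<^sup>2" for k
    by (simp only: row_norm_def rl norm_of_real power2_abs)
  ultimately have "row_norm Dg \<in> l2" by (simp add: l2_def)
  then show ?thesis by (simp add: hs_def rl)
qed

lemma hs_A0: "hs A0"
  unfolding A0_def by (intro hs_add hs_scale hs_Dg hs_K)

lemma app_L:
  assumes "x \<in> l2"
  shows "app (L z) x k = (z + \<mu>) / complex_of_real (w k) * x k - app K x k"
proof -
  have "app (L z) x k = (\<Sum>\<^sub>\<infinity>j. (z + \<mu>) * (Dg k j * x j) + (- 1) * (K k j * x j))"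
    unfolding app_def aff_def A0_def by (rule infsum_cong) (simp add: algebra_simps)
  also have "\<dots> = (\<Sum>\<^sub>\<infinity>j. (z + \<mu>) * (Dg k j * x j)) + (\<Sum>\<^sub>\<infinity>j. (- 1) * (K k j * x j))"
    using hs_Dg hs_K assms
    by (intro infsum_add summable_on_cmult_right l2_Cauchy_Schwarz) (auto simp: hs_def)
  also have "\<dots> = (z + \<mu>) * (\<Sum>\<^sub>\<infinity>j. Dg k j * x j) - app K x k"
    unfolding infsum_cmult_right' by (simp add: app_def)
  also have "(\<Sum>\<^sub>\<infinity>j. Dg k j * x j) = Dg k k * x k"
    by (rule infsum_single_int) (simp add: Dg_def)
  finally show ?thesis by (simp add: Dg_def)
qed

lemma mult_V_eq: "mult_V V u k = complex_of_real (sqrt (w k)) * app K (dn u) k"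
proof -
  have "complex_of_real (sqrt (w k)) * (K k j * dn u j) = V (k - j) * u j" for j
    using sqrt_w_nz[of k] sqrt_w_nz[of j] by (simp add: Kker_def dn_def)
  then show ?thesis
    unfolding app_def mult_V_def infsum_cmult_right'[symmetric] by simp
qed

text \<open>The factorization is coefficientwise and valid on the whole form domain, before it is
  known whether \<open>S u\<close> lies in \<open>l2\<close>; this is what allows membership in
  \<open>D\<close> to be concluded afterwards.\<close>

lemma S_eq:
  assumes "dn u \<in> l2"
  shows "S u k - z * u k = complex_of_real (sqrt (w k)) * (dn u k - app (L z) (dn u) k)"
proof -
  have Dp: "Dpow m pm u k = (complex_of_real (w k) - \<mu>) * u k"
    by (simp add: Dpow_def wt_def)
  have 1: "complex_of_real (sqrt (w k)) * dn u k = complex_of_real (w k) * u k"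
    by (simp add: dn_def w_sq mult.assoc[symmetric])
  have "complex_of_real (sqrt (w k)) * ((z + \<mu>) / complex_of_real (w k) * dn u k)
      = (z + \<mu>) / complex_of_real (w k) * (complex_of_real (sqrt (w k)) * dn u k)"
    by (simp add: mult_ac)
  also have "\<dots> = (z + \<mu>) * u k" unfolding 1 using w_pos[of k] by simp
  finally have 2: "complex_of_real (sqrt (w k)) * ((z + \<mu>) / complex_of_real (w k) * dn u k) = (z + \<mu>) * u k" .
  show ?thesis
    unfolding app_L[OF assms] S_op_def Dp mult_V_eq right_diff_distrib 1 2 by (simp add: algebra_simps)
qed

lemma S_solve:
  assumes "dn u \<in> l2"
  shows "(\<lambda>k. S u k - z * u k) = f \<longleftrightarrow> (\<lambda>k. dn u k - app (L z) (dn u) k) = up f"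
  unfolding S_eq[OF assms] up_def using sqrt_w_nz by (auto simp: fun_eq_iff field_simps)

text \<open>The domain condition comes for free from the equation: S u = f + z u is a sum of two
  elements of \<open>l2\<close>.\<close>

lemma solution_in_D:
  assumes x: "x \<in> l2" and f: "f \<in> l2" and eq: "(\<lambda>k. x k - app (L z) x k) = up f"
  shows "up x \<in> D" and "(\<lambda>k. S (up x) k - z * up x k) = f"
proof -
  have d: "dn (up x) \<in> l2" using x by (simp add: dn_up)
  show 1: "(\<lambda>k. S (up x) k - z * up x k) = f"
    using S_solve[OF d, of z f] eq by (simp add: dn_up)
  have "(\<lambda>k. (S (up x) k - z * up x k) + z * up x k) \<in> l2"
    by (rule l2_add(1)) (use 1 f up_l2(1)[OF x] in \<open>auto intro: l2_scale\<close>)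
  then show "up x \<in> D" using d by (simp add: D_iff)
qed

lemma resolvent_setI:
  assumes ex: "\<And>g. g \<in> l2 \<Longrightarrow> \<exists>x\<in>l2. (\<lambda>k. x k - app (L z) x k) = g \<and> l2_norm x \<le> C * l2_norm g"
    and uniq: "\<And>g x y. \<lbrakk>g \<in> l2; x \<in> l2; y \<in> l2; (\<lambda>k. x k - app (L z) x k) = g;
        (\<lambda>k. y k - app (L z) y k) = g\<rbrakk> \<Longrightarrow> x = y"
  shows "z \<in> resolvent_set D S"
    and "f \<in> l2 \<Longrightarrow> \<exists>x\<in>l2. (\<lambda>k. x k - app (L z) x k) = up f \<and> resolvent D S z f = up x"
proof -
  have U: "u = up x" if f: "f \<in> l2" and x: "x \<in> l2" "(\<lambda>k. x k - app (L z) x k) = up f"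
    and u: "u \<in> D" "(\<lambda>k. S u k - z * u k) = f" for f x u
  proof -
    have d: "dn u \<in> l2" using u by (simp add: D_iff)
    have "(\<lambda>k. dn u k - app (L z) (dn u) k) = up f" using S_solve[OF d] u(2) by blast
    then have "dn u = x" by (intro uniq[OF up_l2(1)[OF f] d x(1) _ x(2)])
    then show ?thesis using up_dn[of u] by simp
  qed
  have E: "\<exists>x\<in>l2. (\<lambda>k. x k - app (L z) x k) = up f \<and> l2_norm x \<le> C * l2_norm (up f)" if "f \<in> l2" for f
    using ex[OF up_l2(1)[OF that]] .
  have E1: "\<exists>!u. u \<in> D \<and> (\<lambda>k. S u k - z * u k) = f" if f: "f \<in> l2" for f
  proof -
    obtain x where x: "x \<in> l2" "(\<lambda>k. x k - app (L z) x k) = up f" using E[OF f] by blast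
    show ?thesis
      by (rule ex1I[of _ "up x"]) (use solution_in_D[OF x(1) f x(2)] U[OF f x] in blast)+
  qed
  \<comment> \<open>The constant from the existence hypothesis carries no sign, hence the absolute
    value; \<open>up\<close> does not increase norms because w \<ge> 1.\<close>
  have bd: "l2_norm u \<le> \<bar>C\<bar> * l2_norm (\<lambda>k. S u k - z * u k)" if u: "u \<in> D" for u
  proof -
    let ?f = "\<lambda>k. S u k - z * u k"
    have f: "?f \<in> l2" using u D_l2[OF u] by (intro l2_diff l2_scale) (auto simp: D_iff)
    obtain x where x: "x \<in> l2" "(\<lambda>k. x k - app (L z) x k) = up ?f" "l2_norm x \<le> C * l2_norm (up ?f)"
      using E[OF f] by blast
    have "l2_norm u \<le> l2_norm x" using up_l2(2)[OF x(1)] U[OF f x(1,2) u refl] by simp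
    also have "\<dots> \<le> \<bar>C\<bar> * l2_norm (up ?f)"
      using x(3) mult_right_mono[OF abs_ge_self[of C] l2_norm_nonneg[of "up ?f"]] by linarith
    also have "\<dots> \<le> \<bar>C\<bar> * l2_norm ?f" by (intro mult_left_mono up_l2(2)[OF f]) simp
    finally show ?thesis .
  qed
  show "z \<in> resolvent_set D S" unfolding resolvent_set_def using E1 bd by blast
  show "\<exists>x\<in>l2. (\<lambda>k. x k - app (L z) x k) = up f \<and> resolvent D S z f = up x" if f: "f \<in> l2"
  proof -
    obtain x where x: "x \<in> l2" "(\<lambda>k. x k - app (L z) x k) = up f" using E[OF f] by blast
    have "resolvent D S z f = up x" unfolding resolvent_def
      by (rule the1_equality[OF E1[OF f]]) (use solution_in_D[OF x(1) f x(2)] in blast)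
    then show ?thesis using x by blast
  qed
qed

lemma eigenvector:
  assumes x: "x \<in> l2" "x \<noteq> (\<lambda>_. 0)" "app (L z) x = x"
  shows "\<exists>u\<in>D. u \<noteq> (\<lambda>_. 0) \<and> S u = (\<lambda>k. z * u k)"
proof -
  have "(\<lambda>k. x k - app (L z) x k) = up (\<lambda>_. 0)" using x(3) by (simp add: up_def)
  note sol = solution_in_D[OF x(1) l2_zero(1) this]
  have "up x \<noteq> (\<lambda>_. 0)" using x(2) dn_up[of x] by (auto simp: dn_def)
  moreover have "S (up x) = (\<lambda>k. z * up x k)" using sol(2) by (auto simp: fun_eq_iff)
  ultimately show ?thesis using sol(1) by blast
qed

text \<open>The alternative for the pencil restated for \<open>S\<close> itself. Bundling it keeps
  \<open>P\<close>, \<open>\<Delta>\<close> and \<open>b\<close> fixed while \<open>f\<close> varies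
  over \<open>l2\<close>.\<close>

definition fredholm_data :: "real \<Rightarrow> int set \<Rightarrow> (complex \<Rightarrow> complex) \<Rightarrow> (int \<Rightarrow> complex \<Rightarrow> seq) \<Rightarrow> bool" where
  "fredholm_data \<rho> P \<Delta> b \<longleftrightarrow> finite P \<and> \<Delta> holomorphic_on ball 0 \<rho> \<and>
    (\<forall>i k. (\<lambda>z. b i z k) holomorphic_on ball 0 \<rho>) \<and>
    (\<forall>z\<in>ball 0 \<rho>. \<Delta> z = 0 \<longrightarrow> (\<exists>x\<in>l2. x \<noteq> (\<lambda>_. 0) \<and> app (L z) x = x)) \<and>
    (\<forall>z\<in>ball 0 \<rho>. \<Delta> z \<noteq> 0 \<longrightarrow> z \<in> resolvent_set D S) \<and>
    (\<forall>f\<in>l2. \<exists>\<phi> \<psi>. (\<forall>k. (\<lambda>z. \<phi> z k) holomorphic_on ball 0 \<rho>) \<and>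
        (\<forall>i\<in>P. \<psi> i holomorphic_on ball 0 \<rho>) \<and>
        (\<forall>z\<in>ball 0 \<rho>. \<Delta> z \<noteq> 0 \<longrightarrow>
           resolvent D S z f = up (\<lambda>k. \<phi> z k + (\<Sum>i\<in>P. \<psi> i z * b i z k) / \<Delta> z)))"

lemma fredholm_data_exists: "\<exists>P \<Delta> b. fredholm_data \<rho> P \<Delta> b"
proof -
  obtain P :: "int set" and \<Delta> b where F: "finite P" "\<Delta> holomorphic_on ball 0 \<rho>"
    "\<forall>i k. (\<lambda>z. b i z k) holomorphic_on ball 0 \<rho>"
    "\<forall>z\<in>ball 0 \<rho>. \<Delta> z = 0 \<longrightarrow> (\<exists>x\<in>l2. x \<noteq> (\<lambda>_. 0) \<and> app (L z) x = x)"
    "\<forall>z\<in>ball 0 \<rho>. \<Delta> z \<noteq> 0 \<longrightarrow> (\<exists>C. \<forall>g\<in>l2. \<exists>x\<in>l2. (\<lambda>k. x k - app (L z) x k) = g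
        \<and> l2_norm x \<le> C * l2_norm g)"
    "\<forall>g\<in>l2. \<exists>\<phi> \<psi>. (\<forall>k. (\<lambda>z. \<phi> z k) holomorphic_on ball 0 \<rho>) \<and>
        (\<forall>i\<in>P. \<psi> i holomorphic_on ball 0 \<rho>) \<and>
        (\<forall>z\<in>ball 0 \<rho>. \<Delta> z \<noteq> 0 \<longrightarrow> (\<forall>x\<in>l2. (\<lambda>k. x k - app (L z) x k) = g \<longrightarrow>
           (\<forall>k. x k = \<phi> z k + (\<Sum>i\<in>P. \<psi> i z * b i z k) / \<Delta> z)))"
    using analytic_Fredholm[OF hs_A0 hs_Dg, of \<rho>] by (elim exE conjE) (rule that)
  have R: "z \<in> resolvent_set D S \<and>
      (\<forall>f\<in>l2. \<exists>x\<in>l2. (\<lambda>k. x k - app (L z) x k) = up f \<and> resolvent D S z f = up x)"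
    if z: "z \<in> ball 0 \<rho>" "\<Delta> z \<noteq> 0" for z
  proof -
    obtain C where C: "\<And>g. g \<in> l2 \<Longrightarrow> \<exists>x\<in>l2. (\<lambda>k. x k - app (L z) x k) = g \<and> l2_norm x \<le> C * l2_norm g"
      using F(5) z by blast
    \<comment> \<open>The right-hand side of the solution formula does not mention the solution, so
      any two solutions agree.\<close>
    have uniq: "x = y" if g: "g \<in> l2" and x: "x \<in> l2" "y \<in> l2" "(\<lambda>k. x k - app (L z) x k) = g"
        "(\<lambda>k. y k - app (L z) y k) = g" for g x y
    proof -
      obtain \<phi> \<psi> where "\<forall>z\<in>ball 0 \<rho>. \<Delta> z \<noteq> 0 \<longrightarrow> (\<forall>x\<in>l2. (\<lambda>k. x k - app (L z) x k) = g \<longrightarrow>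
           (\<forall>k. x k = \<phi> z k + (\<Sum>i\<in>P. \<psi> i z * b i z k) / \<Delta> z))"
        using bspec[OF F(6) g] by (elim exE conjE) (rule that)
      then have fm: "\<forall>x\<in>l2. (\<lambda>k. x k - app (L z) x k) = g \<longrightarrow>
           (\<forall>k. x k = \<phi> z k + (\<Sum>i\<in>P. \<psi> i z * b i z k) / \<Delta> z)"
        using z by simp
      have "x k = y k" for k
        using fm[rule_format, OF x(1,3), of k] fm[rule_format, OF x(2,4), of k] by (simp only:)
      then show ?thesis by (rule ext)
    qed
    show ?thesis using resolvent_setI[OF C uniq] by simp
  qed
  have "\<forall>f\<in>l2. \<exists>\<phi> \<psi>. (\<forall>k. (\<lambda>z. \<phi> z k) holomorphic_on ball 0 \<rho>) \<and>
        (\<forall>i\<in>P. \<psi> i holomorphic_on ball 0 \<rho>) \<and>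
        (\<forall>z\<in>ball 0 \<rho>. \<Delta> z \<noteq> 0 \<longrightarrow>
           resolvent D S z f = up (\<lambda>k. \<phi> z k + (\<Sum>i\<in>P. \<psi> i z * b i z k) / \<Delta> z))"
  proof
    fix f assume f: "f \<in> l2"
    obtain \<phi> \<psi> where h: "\<forall>k. (\<lambda>z. \<phi> z k) holomorphic_on ball 0 \<rho>"
      "\<forall>i\<in>P. \<psi> i holomorphic_on ball 0 \<rho>"
      and fm: "\<forall>z\<in>ball 0 \<rho>. \<Delta> z \<noteq> 0 \<longrightarrow> (\<forall>x\<in>l2. (\<lambda>k. x k - app (L z) x k) = up f \<longrightarrow>
           (\<forall>k. x k = \<phi> z k + (\<Sum>i\<in>P. \<psi> i z * b i z k) / \<Delta> z))"
      using bspec[OF F(6) up_l2(1)[OF f]] by (elim exE conjE) (rule that)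
    have "resolvent D S z f = up (\<lambda>k. \<phi> z k + (\<Sum>i\<in>P. \<psi> i z * b i z k) / \<Delta> z)"
      if z: "z \<in> ball 0 \<rho>" "\<Delta> z \<noteq> 0" for z
    proof -
      obtain x where x: "x \<in> l2" "(\<lambda>k. x k - app (L z) x k) = up f" "resolvent D S z f = up x"
        using R[OF z] f by blast
      have "x = (\<lambda>k. \<phi> z k + (\<Sum>i\<in>P. \<psi> i z * b i z k) / \<Delta> z)"
        by (rule ext, rule fm[rule_format, OF z x(1,2)])
      with x(3) show ?thesis by (simp only:)
    qed
    then show "\<exists>\<phi> \<psi>. (\<forall>k. (\<lambda>z. \<phi> z k) holomorphic_on ball 0 \<rho>) \<and>
        (\<forall>i\<in>P. \<psi> i holomorphic_on ball 0 \<rho>) \<and>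
        (\<forall>z\<in>ball 0 \<rho>. \<Delta> z \<noteq> 0 \<longrightarrow>
           resolvent D S z f = up (\<lambda>k. \<phi> z k + (\<Sum>i\<in>P. \<psi> i z * b i z k) / \<Delta> z))"
      by (intro exI[of _ \<phi>] exI[of _ \<psi>] conjI h ballI impI)
  qed
  moreover have "\<forall>z\<in>ball 0 \<rho>. \<Delta> z \<noteq> 0 \<longrightarrow> z \<in> resolvent_set D S" using R by simp
  ultimately have "fredholm_data \<rho> P \<Delta> b"
    unfolding fredholm_data_def by (intro conjI F(1-4))
  then show ?thesis by (intro exI)
qed

text \<open>The Fredholm alternative: a point that is not regular must be a zero of the determinant.
  The radius only has to exceed the modulus of z.\<close>

lemma spectrum_eigenvalue:
  assumes "z \<notin> resolvent_set D S"
  shows "\<exists>u\<in>D. u \<noteq> (\<lambda>_. 0) \<and> S u = (\<lambda>k. z * u k)"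
proof -
  obtain P \<Delta> b where F: "fredholm_data (cmod z + 1) P \<Delta> b" using fredholm_data_exists by blast
  have z: "z \<in> ball 0 (cmod z + 1)" by simp
  then have "\<Delta> z = 0" using F assms unfolding fredholm_data_def by blast
  then obtain x where "x \<in> l2" "x \<noteq> (\<lambda>_. 0)" "app (L z) x = x"
    using F z unfolding fredholm_data_def by blast
  then show ?thesis by (rule eigenvector)
qed

section \<open>The regular point and the quadratic form\<close>

lemma L_at_minus_mu: "L (- complex_of_real \<mu>) = (\<lambda>k j. - K k j)"
  by (auto simp: aff_def A0_def)

lemma hs_L_mu: "hs (L (- complex_of_real \<mu>))" "hs_norm (L (- complex_of_real \<mu>)) \<le> 1/2"
  unfolding L_at_minus_mu using hs_mono[OF hs_K, of "\<lambda>k j. - K k j"] half by auto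

lemma not_eigen_minus_mu:
  assumes "x \<in> l2" "app (L (- complex_of_real \<mu>)) x = x" shows "x = (\<lambda>_. 0)"
proof -
  have "l2_norm x \<le> 1/2 * l2_norm x" using app_half[OF hs_L_mu l2_zero(1) assms(1)] assms(2) by simp
  then have "l2_norm x = 0" using l2_norm_nonneg[of x] by linarith
  then show ?thesis using l2_norm_eq_0[OF assms(1)] by simp
qed

lemma minus_mu_resolvent: "- complex_of_real \<mu> \<in> resolvent_set D S"
proof (rule ccontr)
  assume "- complex_of_real \<mu> \<notin> resolvent_set D S"
  from spectrum_eigenvalue[OF this] obtain u
    where u: "u \<in> D" "u \<noteq> (\<lambda>_. 0)" "S u = (\<lambda>k. - complex_of_real \<mu> * u k)" by blast
  have d: "dn u \<in> l2" using u(1) by (simp add: D_iff)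
  have "(\<lambda>k. S u k - (- complex_of_real \<mu>) * u k) = (\<lambda>_. 0)" using u(3) by simp
  then have "(\<lambda>k. dn u k - app (L (- complex_of_real \<mu>)) (dn u) k) = up (\<lambda>_. 0)"
    using S_solve[OF d] by blast
  then have "app (L (- complex_of_real \<mu>)) (dn u) = dn u" by (simp add: up_def fun_eq_iff)
  from not_eigen_minus_mu[OF d this] have "up (dn u) = (\<lambda>_. 0)" by (simp add: up_def)
  then show False using u(2) by (simp add: up_dn)
qed

lemma S_mu:
  assumes "u \<in> D"
  shows "S u k + complex_of_real \<mu> * u k = complex_of_real (sqrt (w k)) * (dn u k + app K (dn u) k)"
proof -
  have d: "dn u \<in> l2" using assms by (simp add: D_iff)
  show ?thesis using S_eq[OF d, of k "- complex_of_real \<mu>"] app_L[OF d, of "- complex_of_real \<mu>" k] by simp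
qed

lemma inner_left:
  assumes "u \<in> D"
  shows "l2_inner (\<lambda>k. S u k + complex_of_real \<mu> * u k) v
    = l2_inner (\<lambda>k. dn u k + app K (dn u) k) (dn v)"
  unfolding l2_inner_def S_mu[OF assms] by (simp add: dn_def mult_ac)

lemma inner_right:
  assumes "v \<in> D"
  shows "l2_inner u (\<lambda>k. S v k + complex_of_real \<mu> * v k)
    = l2_inner (dn u) (\<lambda>k. dn v k + app K (dn v) k)"
  unfolding l2_inner_def S_mu[OF assms] by (simp add: dn_def mult_ac)

text \<open>In the coordinate \<open>dn u\<close> the shifted form is the squared norm plus the form
  of \<open>K\<close>; the smallness of \<open>K\<close> thus directly measures the opening
  angle.\<close>

lemma form_value:
  assumes u: "u \<in> D"
  shows "\<exists>c. l2_inner (\<lambda>k. S u k + complex_of_real \<mu> * u k) u = complex_of_real ((l2_norm (dn u))\<^sup>2) + c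
    \<and> cmod c \<le> hs_norm K * (l2_norm (dn u))\<^sup>2"
proof -
  have d: "dn u \<in> l2" using u by (simp add: D_iff)
  have "cmod (l2_inner (app K (dn u)) (dn u)) \<le> l2_norm (app K (dn u)) * l2_norm (dn u)"
    by (rule l2_inner_bound[OF app_l2(1)[OF hs_K d] d])
  also have "\<dots> \<le> hs_norm K * l2_norm (dn u) * l2_norm (dn u)"
    by (intro mult_right_mono app_l2(2)[OF hs_K d]) simp
  finally show ?thesis
    unfolding inner_left[OF u] l2_inner_add_left[OF d app_l2(1)[OF hs_K d] d] l2_inner_self[OF d]
    by (intro exI[of _ "l2_inner (app K (dn u)) (dn u)"]) (simp add: power2_eq_square mult.assoc)
qed

end

section \<open>Discreteness of the spectrum\<close>

lemma finite_dimI: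
  assumes "finite J" "\<And>v. v \<in> X \<Longrightarrow> \<exists>c. v = (\<lambda>k. \<Sum>j\<in>J. c j * \<beta> j k)"
  shows "finite_dim X"
proof -
  define n where "n = card J"
  obtain h where h: "bij_betw h {..<n} J"
    using ex_bij_betw_nat_finite[OF assms(1)] by (auto simp: n_def atLeast0LessThan)
  have "\<exists>c. v = (\<lambda>k. \<Sum>j<n. c j * \<beta> (h j) k)" if "v \<in> X" for v
  proof -
    obtain c where c: "v = (\<lambda>k. \<Sum>j\<in>J. c j * \<beta> j k)" using assms(2)[OF \<open>v \<in> X\<close>] by blast
    have "(\<Sum>j\<in>J. c j * \<beta> j k) = (\<Sum>j<n. c (h j) * \<beta> (h j) k)" for k
      using sum.reindex_bij_betw[OF h, of "\<lambda>j. c j * \<beta> j k"] by simp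
    then show ?thesis using c by (intro exI[of _ "\<lambda>j. c (h j)"]) (simp only:)
  qed
  then show ?thesis unfolding finite_dim_def by (intro exI[of _ n] exI[of _ "\<lambda>j. \<beta> (h j)"] ballI)
qed

text \<open>Cauchy's formula for the derivative of order n - 1, expanded by the Leibniz rule. The
  point is the shape of the result: \<open>b\<close> enters only through finitely many derivatives
  at \<open>w\<close>, and \<open>h\<close> only through scalars.\<close>

lemma contour_integral_pole:
  assumes r: "0 < r" "r < R" and n: "0 < n"
    and h: "h holomorphic_on ball w R" and b: "b holomorphic_on ball w R"
  shows "((\<lambda>z. h z * b z / (z - w) ^ n) has_contour_integral
    2 * pi * \<i> * (\<Sum>a<n. of_nat ((n - 1) choose a) / fact (n - 1) * (deriv ^^ a) h w
       * (deriv ^^ (n - 1 - a)) b w)) (circlepath w r)"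
proof -
  have sub: "cball w r \<subseteq> ball w R" using r by (simp add: cball_subset_ball_iff)
  have hb: "(\<lambda>z. h z * b z) holomorphic_on ball w R" by (intro holomorphic_intros h b)
  have "((\<lambda>u. h u * b u / (u - w) ^ Suc (n - 1)) has_contour_integral
      complex_of_real (2 * pi) * \<i> / fact (n - 1) * (deriv ^^ (n - 1)) (\<lambda>z. h z * b z) w) (circlepath w r)"
  proof (rule Cauchy_has_contour_integral_higher_derivative_circlepath)
    show "continuous_on (cball w r) (\<lambda>z. h z * b z)"
      using holomorphic_on_imp_continuous_on[OF hb] sub continuous_on_subset by blast
    show "(\<lambda>z. h z * b z) holomorphic_on ball w r"
      using holomorphic_on_subset[OF hb] sub ball_subset_cball by blast
    show "w \<in> ball w r" using r by simp
  qed
  moreover have "(deriv ^^ (n - 1)) (\<lambda>z. h z * b z) w =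
      (\<Sum>a = 0..n - 1. of_nat ((n - 1) choose a) * (deriv ^^ a) h w * (deriv ^^ (n - 1 - a)) b w)"
    by (rule higher_deriv_mult[OF h b]) (use r in auto)
  moreover have "{0..n - 1} = {..<n}" using n by auto
  moreover have "2 * pi * \<i> / fact (n - 1) * (\<Sum>a<n. of_nat ((n - 1) choose a) * (deriv ^^ a) h w * (deriv ^^ (n - 1 - a)) b w)
      = 2 * pi * \<i> * (\<Sum>a<n. of_nat ((n - 1) choose a) / fact (n - 1) * (deriv ^^ a) h w * (deriv ^^ (n - 1 - a)) b w)"
    unfolding sum_distrib_left by (rule sum.cong) simp_all
  ultimately show ?thesis using n by simp
qed

context symmetrized
begin

lemma isolated_finite_multiplicity:
  assumes spec: "w0 \<in> op_spectrum D S"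
  shows "\<exists>r>0. (\<forall>z. 0 < cmod (z - w0) \<and> cmod (z - w0) \<le> r \<longrightarrow> z \<in> resolvent_set D S) \<and>
            finite_dim (riesz_range D S w0 r)"
proof -
  \<comment> \<open>The disc contains both \<open>w0\<close>, a zero of the determinant, and
    \<open>- \<mu>\<close>, where the determinant is nonzero; hence it is not constant and the zero
    is isolated.\<close>
  define \<rho> where "\<rho> = cmod w0 + \<mu> + 1"
  obtain P \<Delta> b where F: "fredholm_data \<rho> P \<Delta> b" using fredholm_data_exists by blast
  have fin: "finite P" and hol\<Delta>: "\<Delta> holomorphic_on ball 0 \<rho>"
    and holb: "\<forall>i k. (\<lambda>z. b i z k) holomorphic_on ball 0 \<rho>"
    and eig: "\<forall>z\<in>ball 0 \<rho>. \<Delta> z = 0 \<longrightarrow> (\<exists>x\<in>l2. x \<noteq> (\<lambda>_. 0) \<and> app (L z) x = x)"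
    and res: "\<forall>z\<in>ball 0 \<rho>. \<Delta> z \<noteq> 0 \<longrightarrow> z \<in> resolvent_set D S"
    and fm: "\<forall>f\<in>l2. \<exists>\<phi> \<psi>. (\<forall>k. (\<lambda>z. \<phi> z k) holomorphic_on ball 0 \<rho>) \<and>
        (\<forall>i\<in>P. \<psi> i holomorphic_on ball 0 \<rho>) \<and>
        (\<forall>z\<in>ball 0 \<rho>. \<Delta> z \<noteq> 0 \<longrightarrow>
           resolvent D S z f = up (\<lambda>k. \<phi> z k + (\<Sum>i\<in>P. \<psi> i z * b i z k) / \<Delta> z))"
    using F unfolding fredholm_data_def by - (elim conjE, assumption)+
  have w0: "w0 \<in> ball 0 \<rho>" and mub: "- complex_of_real \<mu> \<in> ball 0 \<rho>"
    using mu norm_ge_zero[of w0] by (auto simp: \<rho>_def simp del: norm_ge_zero)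
  have d0: "\<Delta> w0 = 0" using bspec[OF res w0] spec by (auto simp: op_spectrum_def)
  have dm: "\<Delta> (- complex_of_real \<mu>) \<noteq> 0"
    using bspec[OF eig mub] not_eigen_minus_mu by blast
  have nc: "\<not> \<Delta> constant_on ball 0 \<rho>"
    using d0 dm w0 mub unfolding constant_on_def by metis
  obtain g R n where n: "0 < n" and R: "0 < R" "ball w0 R \<subseteq> ball 0 \<rho>"
    and g: "g holomorphic_on ball w0 R"
    and fac: "\<And>z. z \<in> ball w0 R \<Longrightarrow> \<Delta> z = (z - w0) ^ n * g z"
    and gnz: "\<And>z. z \<in> ball w0 R \<Longrightarrow> g z \<noteq> 0"
    by (rule holomorphic_factor_zero_nonconstant[OF hol\<Delta> open_ball connected_ball w0 d0 nc])
      (rule that, assumption+)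
  define r where "r = R / 2"
  have r: "0 < r" "r < R" using R by (auto simp: r_def)
  have nz: "z \<in> ball w0 R \<and> z \<in> ball 0 \<rho> \<and> \<Delta> z \<noteq> 0" if "0 < cmod (z - w0)" "cmod (z - w0) \<le> r" for z
  proof -
    have "z \<in> ball w0 R" using that r by (simp add: dist_norm norm_minus_commute)
    then show ?thesis using fac[of z] gnz[of z] R(2) that by auto
  qed
  \<comment> \<open>The spanning family does not involve \<open>f\<close>: card P times the order n
    of the zero bounds the rank of the projection. The part \<open>\<phi>\<close> contributes
    nothing by Cauchy's theorem.\<close>
  let ?\<beta> = "\<lambda>(i, a) k. (deriv ^^ (n - 1 - a)) (\<lambda>z. b i z k) w0 / complex_of_real (sqrt (w k))"
  have "finite_dim (riesz_range D S w0 r)"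
  proof (rule finite_dimI[where J="P \<times> {..<n}" and \<beta>="?\<beta>"])
    show "finite (P \<times> {..<n})" using fin by simp
    fix v assume vr: "v \<in> riesz_range D S w0 r"
    obtain f where f: "f \<in> l2"
      and v: "v = (\<lambda>k. contour_integral (circlepath w0 r) (\<lambda>z. resolvent D S z f k) / (2 * pi * \<i>))"
      using vr unfolding riesz_range_def mem_Collect_eq by (elim exE conjE) (rule that)
    obtain \<phi> \<psi> where hol\<phi>: "\<forall>k. (\<lambda>z. \<phi> z k) holomorphic_on ball 0 \<rho>"
      and hol\<psi>: "\<forall>i\<in>P. \<psi> i holomorphic_on ball 0 \<rho>"
      and rs: "\<forall>z\<in>ball 0 \<rho>. \<Delta> z \<noteq> 0 \<longrightarrow>
           resolvent D S z f = up (\<lambda>k. \<phi> z k + (\<Sum>i\<in>P. \<psi> i z * b i z k) / \<Delta> z)"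
      using bspec[OF fm f] by (elim exE conjE) (rule that)
    define h where "h i z = \<psi> i z / g z" for i z
    have holh: "h i holomorphic_on ball w0 R" if "i \<in> P" for i
      unfolding h_def
      by (rule holomorphic_on_divide[OF holomorphic_on_subset[OF bspec[OF hol\<psi> that] R(2)] g gnz])
    define c where "c = (\<lambda>(i, a). of_nat ((n - 1) choose a) / fact (n - 1) * (deriv ^^ a) (h i) w0)"
    have "v k = (\<Sum>j\<in>P \<times> {..<n}. c j * ?\<beta> j k)" for k
    proof -
      let ?s = "complex_of_real (sqrt (w k))"
      let ?I = "\<lambda>i. 2 * pi * \<i> * (\<Sum>a<n. of_nat ((n - 1) choose a) / fact (n - 1) * (deriv ^^ a) (h i) w0
       * (deriv ^^ (n - 1 - a)) (\<lambda>z. b i z k) w0)"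
      have 1: "((\<lambda>z. h i z * b i z k / (z - w0) ^ n) has_contour_integral ?I i) (circlepath w0 r)"
        if "i \<in> P" for i
        by (rule contour_integral_pole[OF r n holh[OF that] holomorphic_on_subset[OF holb[rule_format] R(2)]])
      have 2: "((\<lambda>z. \<phi> z k) has_contour_integral 0) (circlepath w0 r)"
      proof (rule Cauchy_theorem_convex_simple)
        show "(\<lambda>z. \<phi> z k) holomorphic_on ball w0 R"
          by (rule holomorphic_on_subset[OF hol\<phi>[rule_format] R(2)])
        show "path_image (circlepath w0 r) \<subseteq> ball w0 R" using r by auto
      qed auto
      have 3: "((\<lambda>z. (\<phi> z k + (\<Sum>i\<in>P. h i z * b i z k / (z - w0) ^ n)) / ?s)
          has_contour_integral (0 + (\<Sum>i\<in>P. ?I i)) / ?s) (circlepath w0 r)"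
        by (intro has_contour_integral_div has_contour_integral_add has_contour_integral_sum 1 2 fin)
      have "((\<lambda>z. resolvent D S z f k) has_contour_integral (0 + (\<Sum>i\<in>P. ?I i)) / ?s) (circlepath w0 r)"
      proof (rule has_contour_integral_eq[OF 3])
        fix z assume "z \<in> path_image (circlepath w0 r)"
        then have "cmod (z - w0) = r" using r by (auto simp: dist_norm norm_minus_commute)
        then have z: "z \<in> ball w0 R" "z \<in> ball 0 \<rho>" "\<Delta> z \<noteq> 0" using nz[of z] r by auto
        have "(\<Sum>i\<in>P. h i z * b i z k / (z - w0) ^ n) = (\<Sum>i\<in>P. \<psi> i z * b i z k) / \<Delta> z"
          unfolding fac[OF z(1)] h_def sum_divide_distrib by (rule sum.cong) (auto simp: mult_ac)
        then show "(\<phi> z k + (\<Sum>i\<in>P. h i z * b i z k / (z - w0) ^ n)) / ?s = resolvent D S z f k"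
          using rs z(2,3) by (simp add: up_def)
      qed
      then have "v k = (\<Sum>i\<in>P. ?I i) / ?s / (2 * pi * \<i>)"
        unfolding v by (simp add: contour_integral_unique)
      also have "\<dots> = (\<Sum>i\<in>P. \<Sum>a<n. c (i, a) * ?\<beta> (i, a) k)"
        unfolding c_def sum_divide_distrib sum_distrib_left by (intro sum.cong refl) simp
      also have "\<dots> = (\<Sum>j\<in>P \<times> {..<n}. c j * ?\<beta> j k)"
        unfolding sum.cartesian_product by (rule sum.cong) auto
      finally show ?thesis .
    qed
    then show "\<exists>c. v = (\<lambda>k. \<Sum>j\<in>P \<times> {..<n}. c j * ?\<beta> j k)" by (intro exI[of _ c] ext)
  qed
  then show ?thesis using r(1) nz res by (intro exI[of _ r]) blast
qed

lemma discrete: "discrete_spectrum D S"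
  unfolding discrete_spectrum_def
  using isolated_finite_multiplicity spectrum_eigenvalue by (simp add: op_spectrum_def)

section \<open>Sectoriality\<close>

text \<open>The vertex is \<open>- \<mu>\<close>. Points outside the sector are regular because the
  spectrum consists of eigenvalues, and for an eigenvector the shifted form is a positive multiple
  of z + \<mu>, which puts the eigenvalue in the sector.\<close>

lemma sectorial:
  assumes \<theta>: "0 \<le> \<theta>" "\<theta> < pi / 2"
    and arg: "\<And>t c. 0 \<le> t \<Longrightarrow> cmod c \<le> hs_norm K * t \<Longrightarrow> \<bar>Arg (complex_of_real t + c)\<bar> \<le> \<theta>"
  shows "u \<in> D \<Longrightarrow> \<bar>Arg (l2_inner (\<lambda>k. S u k + complex_of_real \<mu> * u k) u)\<bar> \<le> \<theta>"
    and "m_sectorial D S"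
proof -
  show num: "\<bar>Arg (l2_inner (\<lambda>k. S u k + complex_of_real \<mu> * u k) u)\<bar> \<le> \<theta>" if "u \<in> D" for u
    using form_value[OF that] arg[of "(l2_norm (dn u))\<^sup>2"] by auto
  have split: "l2_inner (\<lambda>k. S u k + complex_of_real \<mu> * u k) u
      = l2_inner (S u) u + complex_of_real \<mu> * complex_of_real ((l2_norm u)\<^sup>2)" if "u \<in> D" for u
  proof -
    have "S u \<in> l2" using that by (simp add: D_iff)
    then show ?thesis
      by (simp add: l2_inner_add_left l2_inner_scale_left l2_inner_self D_l2[OF that] l2_scale)
  qed
  have "\<bar>Arg (l2_inner (S u) u - complex_of_real (- \<mu>))\<bar> \<le> \<theta>" if "u \<in> D" "l2_norm u = 1" for u
    using num[OF that(1)] split[OF that(1)] that(2) by simp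
  moreover have "z \<in> resolvent_set D S" if z: "\<bar>Arg (z - complex_of_real (- \<mu>))\<bar> > \<theta>" for z
  proof (rule ccontr)
    assume "z \<notin> resolvent_set D S"
    then obtain u where u: "u \<in> D" "u \<noteq> (\<lambda>_. 0)" "S u = (\<lambda>k. z * u k)"
      using spectrum_eigenvalue by blast
    have Su: "l2_inner (S u) u = z * complex_of_real ((l2_norm u)\<^sup>2)"
      unfolding u(3) l2_inner_scale_left l2_inner_self[OF D_l2[OF u(1)]] ..
    have nu: "(l2_norm u)\<^sup>2 > 0" using l2_norm_eq_0[OF D_l2[OF u(1)]] u(2) by simp
    have "l2_inner (\<lambda>k. S u k + complex_of_real \<mu> * u k) u = complex_of_real ((l2_norm u)\<^sup>2) * (z + complex_of_real \<mu>)"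
      unfolding split[OF u(1)] Su by (simp add: algebra_simps)
    then have "Arg (l2_inner (\<lambda>k. S u k + complex_of_real \<mu> * u k) u) = Arg (z + complex_of_real \<mu>)"
      using Arg_times_of_real[OF nu, of "z + complex_of_real \<mu>"] by (simp only:)
    then show False using num[OF u(1)] z by simp
  qed
  ultimately show "m_sectorial D S"
    unfolding m_sectorial_def using \<theta> by (intro exI[of _ "- \<mu>"] exI[of _ \<theta>]) blast
qed

section \<open>Selfadjointness\<close>

lemma inner_shift:
  assumes "u \<in> D" "v \<in> D"
  shows "l2_inner (\<lambda>k. S u k + complex_of_real \<mu> * u k) v = l2_inner (S u) v + complex_of_real \<mu> * l2_inner u v"
    and "l2_inner u (\<lambda>k. S v k + complex_of_real \<mu> * v k) = l2_inner u (S v) + complex_of_real \<mu> * l2_inner u v"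
proof -
  have l: "S u \<in> l2" "S v \<in> l2" "u \<in> l2" "v \<in> l2"
    using assms D_l2[OF assms(1)] D_l2[OF assms(2)] by (simp_all add: D_iff)
  show "l2_inner (\<lambda>k. S u k + complex_of_real \<mu> * u k) v = l2_inner (S u) v + complex_of_real \<mu> * l2_inner u v"
    unfolding l2_inner_add_left[OF l(1) l2_scale(1)[OF l(3)] l(4)] l2_inner_scale_left ..
  show "l2_inner u (\<lambda>k. S v k + complex_of_real \<mu> * v k) = l2_inner u (S v) + complex_of_real \<mu> * l2_inner u v"
    unfolding l2_inner_add_right[OF l(2) l2_scale(1)[OF l(4)] l(3)] l2_inner_scale_right by simp
qed

text \<open>The real shift and the inner product of \<open>dn u\<close> with \<open>dn v\<close>
  contribute equally to both sides, leaving only the kernel.\<close>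

lemma symmetric_iff:
  assumes "u \<in> D" "v \<in> D"
  shows "l2_inner (S u) v = l2_inner u (S v) \<longleftrightarrow>
    l2_inner (app K (dn u)) (dn v) = l2_inner (dn u) (app K (dn v))"
proof -
  have d: "dn u \<in> l2" "dn v \<in> l2" using assms by (auto simp: D_iff)
  have "l2_inner (S u) v + complex_of_real \<mu> * l2_inner u v = l2_inner (dn u) (dn v) + l2_inner (app K (dn u)) (dn v)"
    unfolding inner_shift(1)[OF assms, symmetric] inner_left[OF assms(1)]
    by (rule l2_inner_add_left[OF d(1) app_l2(1)[OF hs_K d(1)] d(2)])
  moreover have "l2_inner u (S v) + complex_of_real \<mu> * l2_inner u v = l2_inner (dn u) (dn v) + l2_inner (dn u) (app K (dn v))"
    unfolding inner_shift(2)[OF assms, symmetric] inner_right[OF assms(2)]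
    by (rule l2_inner_add_right[OF d(2) app_l2(1)[OF hs_K d(2)] d(1)])
  ultimately show ?thesis by (metis add_right_cancel add_left_cancel)
qed

text \<open>A symmetric operator is selfadjoint once its shift by some real number is onto; here S +
  \<mu> is onto because \<open>- \<mu>\<close> is regular.\<close>

lemma selfadjoint_if_real:
  assumes real: "\<And>k. V k = cnj (V (- k))"
  shows "selfadjoint D S"
proof -
  have "cnj (K j k) = K k j" for j k
    using real[of "k - j"] by (simp add: Kker_def mult.commute)
  then have adj: "l2_inner (app K x) y = l2_inner x (app K y)" if "x \<in> l2" "y \<in> l2" for x y
    using app_adjoint[OF hs_K that] by simp
  have sym: "l2_inner (S u) v = l2_inner u (S v)" if "u \<in> D" "v \<in> D" for u v
    unfolding symmetric_iff[OF that] using that by (intro adj) (auto simp: D_iff)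
  have "g \<in> D \<and> S g = h"
    if g: "g \<in> l2" and h: "h \<in> l2" and gh: "\<forall>u\<in>D. l2_inner (S u) g = l2_inner u h" for g h
  proof -
    let ?T = "\<lambda>u k. S u k + complex_of_real \<mu> * u k"
    have solve: "\<exists>u\<in>D. ?T u = f" if f: "f \<in> l2" for f
    proof -
      have "\<exists>!u. u \<in> D \<and> (\<lambda>k. S u k - (- complex_of_real \<mu>) * u k) = f"
        using bspec[OF conjunct1[OF minus_mu_resolvent[unfolded resolvent_set_def mem_Collect_eq]] f] .
      from ex1_implies_ex[OF this] show ?thesis unfolding minus_mult_left[symmetric] diff_minus_eq_add
        by (elim exE conjE) (rule bexI)
    qed
    \<comment> \<open>The candidate for \<open>g\<close>: if \<open>g\<close> were in the domain
      with S g = h, it would solve this equation.\<close>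
    obtain g' where g': "g' \<in> D" "?T g' = (\<lambda>k. h k + complex_of_real \<mu> * g k)"
      using solve[OF l2_add(1)[OF h l2_scale(1)[OF g]]] by blast
    have gl: "(\<lambda>k. g k - g' k) \<in> l2" by (rule l2_diff(1)[OF g D_l2[OF g'(1)]])
    have orth: "l2_inner (?T u) (\<lambda>k. g k - g' k) = 0" if u: "u \<in> D" for u
    proof -
      have ul: "u \<in> l2" "S u \<in> l2" using u D_l2[OF u] by (simp_all add: D_iff)
      have Tl: "?T u \<in> l2" by (intro l2_add l2_scale ul)
      have "l2_inner (?T u) g = l2_inner u (\<lambda>k. h k + complex_of_real \<mu> * g k)"
        using gh u by (simp add: l2_inner_add_left l2_inner_add_right l2_inner_scale_left
            l2_inner_scale_right l2_scale ul g h)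
      also have "\<dots> = l2_inner u (?T g')" using g'(2) by simp
      also have "\<dots> = l2_inner (?T u) g'"
        using sym[OF u g'(1)] unfolding inner_shift[OF u g'(1)] by simp
      finally show ?thesis
        by (simp add: l2_inner_diff_right[OF g D_l2[OF g'(1)] Tl])
    qed
    \<comment> \<open>The difference is orthogonal to the range of S + \<mu>, which is everything,
      so it is orthogonal to itself.\<close>
    obtain u where u: "u \<in> D" "?T u = (\<lambda>k. g k - g' k)" using solve[OF gl] by blast
    have "complex_of_real ((l2_norm (\<lambda>k. g k - g' k))\<^sup>2) = 0"
      using orth[OF u(1)] unfolding u(2) l2_inner_self[OF gl] .
    then have "(\<lambda>k. g k - g' k) = (\<lambda>_. 0)" using l2_norm_eq_0[OF gl] by simp
    then have gg: "g = g'" by (simp add: fun_eq_iff)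
    moreover have "S g = h" using g'(2) unfolding gg[symmetric] by (simp add: fun_eq_iff)
    ultimately show ?thesis using g'(1) by simp
  qed
  moreover have "D \<subseteq> l2" using D_l2 by blast
  moreover have "\<forall>u\<in>D. S u \<in> l2" by (simp add: D_iff)
  ultimately show ?thesis unfolding selfadjoint_def by (intro conjI ballI impI sym) simp_all
qed

text \<open>The approximation cannot be made by truncating \<open>x\<close>, since finitely
  supported vectors may fail to lie in the domain. Instead (I + K) x is truncated and the equation
  solved again; the Neumann factor 2 accounts for the tolerance \<epsilon>/2.\<close>

lemma dn_D_dense:
  assumes x: "x \<in> l2" and \<epsilon>: "\<epsilon> > 0"
  shows "\<exists>u\<in>D. l2_norm (\<lambda>k. x k - dn u k) < \<epsilon>"
proof -
  let ?a = "L (- complex_of_real \<mu>)"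
  let ?g = "\<lambda>k. x k - app ?a x k"
  have g: "?g \<in> l2" by (intro l2_diff x app_l2 hs_L_mu)
  obtain P where P: "finite P" "\<And>Q. P \<subseteq> Q \<Longrightarrow> l2_norm (\<lambda>k. if k \<in> Q then 0 else ?g k) < \<epsilon> / 2"
    by (rule l2_tail[OF g, of "\<epsilon> / 2"]) (use \<epsilon> in auto)
  let ?gP = "\<lambda>k. if k \<in> P then ?g k else 0"
  let ?t = "\<lambda>k. if k \<in> P then 0 else ?g k"
  have gP: "?gP \<in> l2" and t: "?t \<in> l2" by (rule l2_mono[OF g]; simp)+
  define y where "y = nsol ?a ?gP"
  have y: "y \<in> l2" unfolding y_def by (rule nsol_l2[OF hs_L_mu gP])
  have yeq: "y k = ?gP k + app ?a y k" for k unfolding y_def by (rule nsol_eq[OF hs_L_mu gP])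
  \<comment> \<open>Finite support survives the unbounded multiplication by w^(1/2), so the
    right-hand side has the form \<open>up f\<close> with \<open>f\<close> in
    \<open>l2\<close>.\<close>
  have "dn ?gP \<in> l2"
    unfolding l2_def by (simp, rule finite_nonzero_values_imp_summable_on)
      (rule finite_subset[OF _ P(1)], auto simp: dn_def)
  moreover have "(\<lambda>k. y k - app ?a y k) = up (dn ?gP)"
    unfolding up_dn
  proof
    show "y k - app ?a y k = ?gP k" for k by (subst (1) yeq) simp
  qed
  ultimately have u: "up y \<in> D" using solution_in_D(1)[OF y] by blast
  let ?d = "\<lambda>k. x k - y k"
  have d: "?d \<in> l2" by (rule l2_diff(1)[OF x y])
  have "?d k = ?t k + app ?a ?d k" for k
    unfolding app_diff[OF hs_L_mu(1) x y] by (subst (1) yeq) simp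
  then have "?d = nsol ?a ?t" by (intro nsol_unique[OF hs_L_mu t d])
  then have "l2_norm ?d \<le> 2 * l2_norm ?t" using nsol_norm[OF hs_L_mu t] by simp
  also have "\<dots> < \<epsilon>" using P(2)[OF order_refl] by simp
  finally show ?thesis using u by (intro bexI[of _ "up y"]) (simp_all add: dn_up)
qed

lemma app_K_e: "app K (e_seq j) i = K i j"
  unfolding app_def by (subst infsum_single_int[of j]) (auto simp: e_seq_def)

text \<open>The sesquilinear defect \<open>q\<close> of symmetry of \<open>K\<close> vanishes on a
  dense set and is continuous, hence vanishes on basis vectors. Its value there compares K n 0 with
  the conjugate of K 0 n, where the weights cancel.\<close>

lemma real_if_selfadjoint:
  assumes "selfadjoint D S"
  shows "V n = cnj (V (- n))"
proof -
  define q where "q x y = l2_inner (app K x) y - l2_inner x (app K y)" for x y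
  have q0: "q (dn u) (dn v) = 0" if "u \<in> D" "v \<in> D" for u v
    using assms symmetric_iff[OF that] that unfolding selfadjoint_def q_def by simp
  have qb: "cmod (q x y) \<le> l2_norm x * l2_norm y" if "x \<in> l2" "y \<in> l2" for x y
  proof -
    have a: "app K x \<in> l2" "app K y \<in> l2" using that by (auto intro: app_l2 hs_K)
    have hf: "l2_norm (app K z) \<le> 1/2 * l2_norm z" if "z \<in> l2" for z
      by (rule app_half[OF hs_K half l2_zero(1) that])
    have "cmod (q x y) \<le> cmod (l2_inner (app K x) y) + cmod (l2_inner x (app K y))"
      unfolding q_def by (rule norm_triangle_ineq4)
    also have "\<dots> \<le> l2_norm (app K x) * l2_norm y + l2_norm x * l2_norm (app K y)"
      by (intro add_mono l2_inner_bound a that)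
    also have "\<dots> \<le> (1/2 * l2_norm x) * l2_norm y + l2_norm x * (1/2 * l2_norm y)"
      by (intro add_mono mult_right_mono mult_left_mono hf that) auto
    finally show ?thesis by simp
  qed
  have qd1: "q (\<lambda>k. x k - x' k) y = q x y - q x' y" if "x \<in> l2" "x' \<in> l2" "y \<in> l2" for x x' y
    using that unfolding q_def app_diff[OF hs_K that(1,2)]
    by (simp add: l2_inner_diff_left app_l2(1)[OF hs_K])
  have qd2: "q x (\<lambda>k. y k - y' k) = q x y - q x y'" if "x \<in> l2" "y \<in> l2" "y' \<in> l2" for x y y'
    using that unfolding q_def app_diff[OF hs_K that(2,3)]
    by (simp add: l2_inner_diff_right app_l2(1)[OF hs_K])
  have q_e: "q (e_seq j) (e_seq i) = K i j - cnj (K j i)" for i j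
    unfolding q_def l2_inner_def
    by (subst (1) infsum_single_int[of i], simp add: e_seq_def,
        subst infsum_single_int[of j]) (simp_all add: app_K_e, simp_all add: e_seq_def)
  have "cmod (q (e_seq 0) (e_seq n)) \<le> 0 + \<epsilon>" if \<epsilon>: "\<epsilon> > 0" for \<epsilon>
  proof -
    \<comment> \<open>The bound 1 keeps the norm of \<open>dn u\<close> at most 2, so the two error
      terms add up to at most \<delta> + 2 \<delta>.\<close>
    define \<delta> where "\<delta> = min 1 (\<epsilon> / 3)"
    have \<delta>: "\<delta> > 0" "\<delta> \<le> 1" "3 * \<delta> \<le> \<epsilon>" using \<epsilon> by (auto simp: \<delta>_def)
    obtain u where u: "u \<in> D" "l2_norm (\<lambda>k. e_seq 0 k - dn u k) < \<delta>"
      using dn_D_dense[OF e_seq_l2(1) \<delta>(1)] by blast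
    obtain v where v: "v \<in> D" "l2_norm (\<lambda>k. e_seq n k - dn v k) < \<delta>"
      using dn_D_dense[OF e_seq_l2(1) \<delta>(1)] by blast
    have d: "dn u \<in> l2" "dn v \<in> l2" using u v by (auto simp: D_iff)
    let ?x = "\<lambda>k. e_seq 0 k - dn u k" and ?y = "\<lambda>k. e_seq n k - dn v k"
    have xy: "?x \<in> l2" "?y \<in> l2" by (intro l2_diff d e_seq_l2)+
    have "l2_norm (dn u) \<le> 2"
    proof -
      have "dn u = (\<lambda>k. e_seq 0 k - ?x k)" by simp
      then have "l2_norm (dn u) \<le> l2_norm (e_seq 0) + l2_norm ?x"
        using l2_diff(2)[OF e_seq_l2(1)[of 0] xy(1)] by simp
      then show ?thesis using u(2) \<delta>(2) e_seq_l2(2)[of 0] by linarith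
    qed
    \<comment> \<open>Replace one argument at a time; the remaining term q (dn u) (dn v) is
      zero.\<close>
    have "q (e_seq 0) (e_seq n) = q ?x (e_seq n) + q (dn u) ?y"
      using q0[OF u(1) v(1)] by (simp add: qd1 qd2 d e_seq_l2)
    then have "cmod (q (e_seq 0) (e_seq n)) \<le> cmod (q ?x (e_seq n)) + cmod (q (dn u) ?y)"
      using norm_triangle_ineq by simp
    also have "\<dots> \<le> l2_norm ?x * l2_norm (e_seq n) + l2_norm (dn u) * l2_norm ?y"
      by (intro add_mono qb xy d e_seq_l2)
    also have "\<dots> \<le> \<delta> * 1 + 2 * \<delta>"
      using u(2) v(2) \<open>l2_norm (dn u) \<le> 2\<close> by (intro add_mono mult_mono) (use \<delta>(1) in \<open>auto simp: e_seq_l2\<close>)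
    finally show ?thesis using \<delta>(3) by simp
  qed
  then have "cmod (q (e_seq 0) (e_seq n)) \<le> 0" by (rule field_le_epsilon)
  then have "K n 0 = cnj (K 0 n)" using q_e[of 0 n] by simp
  then show ?thesis using sqrt_w_nz[of 0] sqrt_w_nz[of n] by (simp add: Kker_def field_simps)
qed

end

section \<open>Opening angle and choice of the shift\<close>

lemma Arg_near_positive:
  assumes "\<epsilon> > 0"
  shows "\<exists>\<eta>>0. \<forall>t c. 0 \<le> t \<longrightarrow> cmod c \<le> \<eta> * t \<longrightarrow> \<bar>Arg (complex_of_real t + c)\<bar> \<le> \<epsilon>"
proof -
  have "isCont Arg 1" by (rule continuous_at_Arg) (simp add: complex_nonpos_Reals_iff)
  then obtain d where d: "d > 0" "\<And>z. dist z 1 < d \<Longrightarrow> dist (Arg z) (Arg 1) < \<epsilon>"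
    using assms unfolding continuous_at_eps_delta by metis
  have "\<bar>Arg (complex_of_real t + c)\<bar> \<le> \<epsilon>" if t: "0 \<le> t" "cmod c \<le> d / 2 * t" for t c
  proof (cases "t = 0")
    \<comment> \<open>Then c = 0, and the convention Arg 0 = 0 applies.\<close>
    case True
    then show ?thesis using t assms by (simp add: Arg_zero)
  next
    case False
    then have tp: "t > 0" using t by simp
    \<comment> \<open>\<open>Arg\<close> is invariant under positive scaling, so continuity at 1
      suffices for all t.\<close>
    have "complex_of_real t + c = complex_of_real t * (1 + c / complex_of_real t)"
      using tp by (simp add: field_simps)
    then have "Arg (complex_of_real t + c) = Arg (1 + c / complex_of_real t)"
      using Arg_times_of_real[OF tp] by (simp only:)
    moreover have "dist (1 + c / complex_of_real t) 1 < d"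
    proof -
      have "dist (1 + c / complex_of_real t) 1 = cmod c / t" using tp by (simp add: dist_norm norm_divide)
      also have "\<dots> \<le> d / 2" using t(2) tp by (simp add: field_simps)
      finally show ?thesis using d(1) by simp
    qed
    ultimately show ?thesis using d(2)[of "1 + c / complex_of_real t"] by (simp add: dist_real_def)
  qed
  then show ?thesis using d(1) by (intro exI[of _ "d / 2"]) auto
qed

text \<open>The minimum of the angular tolerance and 1/2 makes a single \<open>\<mu>\<close> meet
  both the sector estimate and the locale assumption.\<close>

lemma symmetrized_sector:
  assumes "m \<ge> 1" "V \<in> Hs True (- real m)" "0 < \<epsilon>"
  shows "\<exists>\<mu>. symmetrized m V pm \<mu> \<and> (\<forall>t c. 0 \<le> t \<longrightarrow> cmod c \<le> hs_norm (Kker m V pm \<mu>) * t \<longrightarrow>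
      \<bar>Arg (complex_of_real t + c)\<bar> \<le> \<epsilon>)"
proof -
  obtain \<eta> where \<eta>: "\<eta> > 0" "\<And>t c. 0 \<le> t \<Longrightarrow> cmod c \<le> \<eta> * t \<Longrightarrow> \<bar>Arg (complex_of_real t + c)\<bar> \<le> \<epsilon>"
    using Arg_near_positive[OF assms(3)] by blast
  have "min \<eta> (1/2) > 0" using \<eta>(1) by simp
  from Kker_small[OF assms(1,2) this, of pm] obtain \<mu>
    where mu: "\<mu> \<ge> 1" "hs_norm (Kker m V pm \<mu>) \<le> min \<eta> (1/2)" by blast
  have "symmetrized m V pm \<mu>" by unfold_locales (use assms mu in auto)
  moreover have "\<bar>Arg (complex_of_real t + c)\<bar> \<le> \<epsilon>"
    if "0 \<le> t" "cmod c \<le> hs_norm (Kker m V pm \<mu>) * t" for t c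
  proof (rule \<eta>(2)[OF that(1)])
    show "cmod c \<le> \<eta> * t" using that mu(2) mult_right_mono[of "hs_norm (Kker m V pm \<mu>)" \<eta> t] by simp
  qed
  ultimately show ?thesis by blast
qed

theorem theorem4:
  fixes m :: nat and V :: "int \<Rightarrow> complex" and pm :: bool
  assumes "m \<ge> 1"
    and "V \<in> Hs True (- real m)"
  shows "(m_sectorial (S_dom m V pm) (S_op m V pm) \<and>
          (\<forall>\<epsilon>>0. \<exists>c\<ge>0. \<forall>u\<in>S_dom m V pm.
              \<bar>Arg (l2_inner (\<lambda>k. S_op m V pm u k + complex_of_real c * u k) u)\<bar> \<le> \<epsilon>))
       \<and> (selfadjoint (S_dom m V pm) (S_op m V pm) \<longleftrightarrow> (\<forall>k. V k = cnj (V (- k))))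
       \<and> discrete_spectrum (S_dom m V pm) (S_op m V pm)"
proof -
  \<comment> \<open>A sample angle below pi/2, enough for m-sectoriality; arbitrary angles are
    treated separately.\<close>
  have q: "0 < pi / 4" "0 \<le> pi / 4" "pi / 4 < pi / 2" by simp_all
  obtain \<mu>
    where mu: "symmetrized m V pm \<mu>"
      and arg: "\<forall>t c. 0 \<le> t \<longrightarrow> cmod c \<le> hs_norm (Kker m V pm \<mu>) * t \<longrightarrow>
        \<bar>Arg (complex_of_real t + c)\<bar> \<le> pi / 4"
    using symmetrized_sector[OF assms q(1), of pm] by (elim exE conjE) (rule that)
  have sect: "m_sectorial (S_dom m V pm) (S_op m V pm)"
    by (rule symmetrized.sectorial(2)[OF mu q(2,3)]) (use arg in simp)
  have num: "\<exists>c\<ge>0. \<forall>u\<in>S_dom m V pm.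
      \<bar>Arg (l2_inner (\<lambda>k. S_op m V pm u k + complex_of_real c * u k) u)\<bar> \<le> \<epsilon>" if "\<epsilon> > 0" for \<epsilon>
  proof -
    \<comment> \<open>Capped at pi/4 because \<open>symmetrized.sectorial\<close> asks for an angle
      below pi/2, while \<epsilon> is arbitrary; the shift \<open>\<nu>\<close> then serves as the
      constant for \<epsilon>.\<close>
    have \<delta>: "0 < min \<epsilon> (pi / 4)" "0 \<le> min \<epsilon> (pi / 4)" "min \<epsilon> (pi / 4) < pi / 2" using that q by linarith+
    obtain \<nu>
      where nu: "symmetrized m V pm \<nu>"
        and arg: "\<forall>t c. 0 \<le> t \<longrightarrow> cmod c \<le> hs_norm (Kker m V pm \<nu>) * t \<longrightarrow>
          \<bar>Arg (complex_of_real t + c)\<bar> \<le> min \<epsilon> (pi / 4)"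
      using symmetrized_sector[OF assms \<delta>(1), of pm] by (elim exE conjE) (rule that)
    have "\<bar>Arg (l2_inner (\<lambda>k. S_op m V pm u k + complex_of_real \<nu> * u k) u)\<bar> \<le> min \<epsilon> (pi / 4)"
      if "u \<in> S_dom m V pm" for u
      by (rule symmetrized.sectorial(1)[OF nu \<delta>(2,3) _ that]) (use arg in simp)
    then show ?thesis using symmetrized.mu[OF nu] by (intro exI[of _ \<nu>]) auto
  qed
  show ?thesis
    using sect num symmetrized.selfadjoint_if_real[OF mu] symmetrized.real_if_selfadjoint[OF mu]
      symmetrized.discrete[OF mu] by blast
qed

end
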